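(* Let $d\geq 1$ and $1\leq n\leq m$ be integers and put $|\nu|=m-n$. Equip $V_n(\mathbb{C}^m)=V_{m-|\nu|}(\mathbb{C}^m)$ with one of the following two $\mathbb{Z}_2$-actions: (class BDI) $gA=\overline{A}$; or (class CII) $m$ and $n$ are even and $gA=(I_{m/2}\otimes\sigma_2)\,\overline{A}\,(I_{n/2}\otimes\sigma_2)$. In either case, if $|\nu|\geq\lceil d/2\rceil$, then $$\left[\left(I^d,\partial I^d\right),\left(V_{m-|\nu|}(\mathbb{C}^m),E\right)\right]_{\mathbb{Z}_2}=0,$$ i.e. this set of homotopy classes consists of exactly one element.
   Context: $V_n(\mathbb{C}^m)=\{A\in\mathbb{C}^{m\times n}\mid A^\dagger A=I_n\}$ is the complex Stiefel manifold, $I_n$ is the $n\times n$ identity matrix, and $E=(e_1\ \cdots\ e_n)\in V_n(\mathbb{C}^m)$ is the canonical $n$-frame (a fixed point of both actions). $\overline{A}$ is the entrywise complex conjugate and $\sigma_2=\begin{pmatrix}0&-\mathrm{i}\\ \mathrm{i}&0\end{pmatrix}$. $g$ denotes the nontrivial element of $\mathbb{Z}_2$. The cube $I^d$, with $I=[-\pi,\pi]$, carries the $\mathbb{Z}_2$-action $g\mathbf{k}=-\mathbf{k}$. For a $\mathbb{Z}_2$-space $X$ with fixed point $x_0$, $[(I^d,\partial I^d),(X,x_0)]_{\mathbb{Z}_2}$ is the set of homotopy classes of continuous $\mathbb{Z}_2$-equivariant maps $f\colon I^d\to X$ (that is, $f(-\mathbf{k})=gf(\mathbf{k})$) with $f(\partial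 I^d)\subseteq\{x_0\}$, where homotopies are through such maps. *)

theory Defs
  imports "HOL-Analysis.Analysis" "Jordan_Normal_Form.Schur_Decomposition"
begin

text \<open>
  The usual Euclidean topology on complex m-by-n matrices: the coarsest one that makes all
  entries continuous.
\<close>

definition mat_topology :: "nat \<Rightarrow> nat \<Rightarrow> complex mat topology" where
  "mat_topology m n =
     pullback_topology (carrier_mat m n)
       (\<lambda>A. restrict (\<lambda>ij. A $$ ij) ({..<m} \<times> {..<n}))
       (product_topology (\<lambda>_. euclidean) ({..<m} \<times> {..<n}))"

definition stiefel :: "nat \<Rightarrow> nat \<Rightarrow> complex mat set" where
  "stiefel m n = {A \<in> carrier_mat m n. mat_adjoint A * A = 1\<^sub>m n}"

definition stiefel_topology :: "nat \<Rightarrow> nat \<Rightarrow> complex mat topology" where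
  "stiefel_topology m n = subtopology (mat_topology m n) (stiefel m n)"

definition canonical_frame :: "nat \<Rightarrow> nat \<Rightarrow> complex mat" where
  "canonical_frame m n = Matrix.mat m n (\<lambda>(i, j). if i = j then 1 else 0)"

definition kronecker_mat :: "complex mat \<Rightarrow> complex mat \<Rightarrow> complex mat" (infixl "\<otimes>\<^sub>K" 70) where
  "A \<otimes>\<^sub>K B =
     Matrix.mat (dim_row A * dim_row B) (dim_col A * dim_col B)
       (\<lambda>(i, j). A $$ (i div dim_row B, j div dim_col B) * B $$ (i mod dim_row B, j mod dim_col B))"

definition sigma2 :: "complex mat" where
  "sigma2 = mat_of_rows_list 2 [[0, - \<i>], [\<i>, 0]]"

definition bdi_action :: "complex mat \<Rightarrow> complex mat" where
  "bdi_action A = map_mat cnj A"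

text \<open>Only meaningful for even \<open>m\<close> and \<open>n\<close>, because of the division by two.\<close>

definition cii_action :: "nat \<Rightarrow> nat \<Rightarrow> complex mat \<Rightarrow> complex mat" where
  "cii_action m n A = (1\<^sub>m (m div 2) \<otimes>\<^sub>K sigma2) * map_mat cnj A * (1\<^sub>m (n div 2) \<otimes>\<^sub>K sigma2)"

definition cube :: "(real ^ 'd) set" where
  "cube = cbox (\<chi> i. - pi) (\<chi> i. pi)"

definition equivariant_pair_map :: "('b \<Rightarrow> 'b) \<Rightarrow> 'b \<Rightarrow> (real ^ 'd \<Rightarrow> 'b) \<Rightarrow> bool" where
  "equivariant_pair_map g x0 f \<longleftrightarrow>
     f ` frontier cube \<subseteq> {x0} \<and> (\<forall>k\<in>cube. f (- k) = g (f k))"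

definition equivariant_maps ::
    "'b topology \<Rightarrow> ('b \<Rightarrow> 'b) \<Rightarrow> 'b \<Rightarrow> (real ^ 'd \<Rightarrow> 'b) set" where
  "equivariant_maps X g x0 =
     {f. continuous_map (top_of_set cube) X f \<and> equivariant_pair_map g x0 f}"

definition equivariant_homotopy_rel ::
    "'b topology \<Rightarrow> ('b \<Rightarrow> 'b) \<Rightarrow> 'b \<Rightarrow> ((real ^ 'd \<Rightarrow> 'b) \<times> (real ^ 'd \<Rightarrow> 'b)) set" where
  "equivariant_homotopy_rel X g x0 =
     {(f, f'). homotopic_with (equivariant_pair_map g x0) (top_of_set cube) X f f'}"

text \<open>
  A map on the cube is represented by total functions; those that agree on the cube
  are homotopic, so the quotient is the set of homotopy classes of maps on the cube.
\<close>

definition equivariant_homotopy_classes ::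
    "'b topology \<Rightarrow> ('b \<Rightarrow> 'b) \<Rightarrow> 'b \<Rightarrow> (real ^ 'd \<Rightarrow> 'b) set set" where
  "equivariant_homotopy_classes X g x0 =
     equivariant_maps X g x0 // equivariant_homotopy_rel X g x0"

end

theory Submission
  imports Defs
begin

text \<open>
  For unit vectors \<open>u\<close>, \<open>v\<close> with \<open>v \<noteq> - u\<close> there is a unitary map, depending continuously on \<open>u\<close> and \<open>v\<close>, that
  takes \<open>u\<close> to \<open>v\<close>, is the identity for \<open>u = v\<close> and fixes everything orthogonal to \<open>u\<close> and \<open>v\<close>.  Hence
  a homotopy of a single column of a frame, within the vectors that are not opposite to the original
  column, lifts to a homotopy of frames.

  The involution \<open>k \<mapsto> - k\<close> acts freely on the cells \<open>{k. k\<^sub>a > 0, k\<^sub>i = 0 for i \<notin> S \<union> {a}}\<close> and their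
  mirror images, so an equivariant map is deformed over the half cells one after the other, with no
  equivariance condition on each of them.  On a half cell the columns are made constant one after the
  other: column \<open>c\<close> takes values in a sphere of dimension \<open>2 (m - c) - 1 > d\<close>, so by approximation it
  can be moved off \<open>- e\<^sub>c\<close>, and then along straight lines to \<open>e\<^sub>c\<close>.  A homotopy over the half cell
  extends to the cube by damping it in the remaining coordinates.

  What is left is the value at the fixed point \<open>0\<close>.  It is moved to the canonical frame by plane
  rotations that commute with the action, which in class CII means rotating a plane and its image under
  the quaternionic structure simultaneously.
\<close>

section \<open>Hermitian products and transport of unit vectors\<close>

definition ip :: "nat \<Rightarrow> (nat \<Rightarrow> complex) \<Rightarrow> (nat \<Rightarrow> complex) \<Rightarrow> complex" where
  "ip m x y = (\<Sum>i<m. cnj (x i) * y i)"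

definition basis_vec :: "nat \<Rightarrow> nat \<Rightarrow> complex" where
  "basis_vec j i = (if i = j then 1 else 0)"

lemma ip_add_left: "ip m (\<lambda>i. x i + y i) z = ip m x z + ip m y z"
  by (simp add: ip_def algebra_simps sum.distrib)

lemma ip_add_right: "ip m z (\<lambda>i. x i + y i) = ip m z x + ip m z y"
  by (simp add: ip_def algebra_simps sum.distrib)

lemma ip_diff_left: "ip m (\<lambda>i. x i - y i) z = ip m x z - ip m y z"
  by (simp add: ip_def algebra_simps sum_subtractf)

lemma ip_diff_right: "ip m z (\<lambda>i. x i - y i) = ip m z x - ip m z y"
  by (simp add: ip_def algebra_simps sum_subtractf)

lemma ip_scale_left: "ip m (\<lambda>i. a * x i) z = cnj a * ip m x z"
  by (simp add: ip_def sum_distrib_left mult_ac)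

lemma ip_scale_right: "ip m z (\<lambda>i. a * x i) = a * ip m z x"
  by (simp add: ip_def sum_distrib_left mult_ac)

lemma ip_minus_left: "ip m (\<lambda>i. - x i) z = - ip m x z"
  by (simp add: ip_def sum_negf)

lemma ip_minus_right: "ip m z (\<lambda>i. - x i) = - ip m z x"
  by (simp add: ip_def sum_negf)

lemma ip_divide_left: "ip m (\<lambda>i. x i / a) z = ip m x z / cnj a"
  by (simp add: ip_def sum_divide_distrib)

lemma ip_divide_right: "ip m z (\<lambda>i. x i / a) = ip m z x / a"
  by (simp add: ip_def sum_divide_distrib)

lemmas ip_linear = ip_add_left ip_add_right ip_diff_left ip_diff_right ip_scale_left ip_scale_right
  ip_minus_left ip_minus_right ip_divide_left ip_divide_right

lemma cnj_ip: "cnj (ip m x y) = ip m y x"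
  by (simp add: ip_def mult_ac)

lemma ip_cong: "\<lbrakk>\<And>i. i < m \<Longrightarrow> x i = x' i; \<And>i. i < m \<Longrightarrow> y i = y' i\<rbrakk> \<Longrightarrow> ip m x y = ip m x' y'"
  by (auto simp: ip_def intro!: sum.cong)

lemma ip_basis_left: "j < m \<Longrightarrow> ip m (basis_vec j) x = x j"
  by (simp add: ip_def basis_vec_def if_distrib[of cnj] if_distrib[of "\<lambda>z. z * _"] cong: if_cong)

lemma ip_basis_right: "j < m \<Longrightarrow> ip m x (basis_vec j) = cnj (x j)"
  by (metis cnj_ip ip_basis_left)

lemma basis_vec_unit: "c < m \<Longrightarrow> ip m (basis_vec c) (basis_vec c) = 1"
  by (simp add: ip_basis_left) (simp add: basis_vec_def)

lemma ip_disjoint: "(\<And>i. i < m \<Longrightarrow> x i = 0 \<or> y i = 0) \<Longrightarrow> ip m x y = 0"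
  by (auto simp: ip_def intro!: sum.neutral)

lemma ip_self: "ip m x x = complex_of_real (\<Sum>i<m. (cmod (x i))\<^sup>2)"
  by (simp add: ip_def mult.commute flip: complex_norm_square)

lemma Re_ip_self_pos:
  assumes "i < m" "x i \<noteq> 0"
  shows "0 < Re (ip m x x)"
proof -
  have "0 < (\<Sum>i<m. (cmod (x i))\<^sup>2)"
    by (rule sum_pos2[of _ i]) (use assms in auto)
  then show ?thesis by (simp add: ip_self)
qed

lemma ip_self_Re: "ip m x x = of_real (Re (ip m x x))"
  by (simp add: ip_self)

lemma ip_self_eq_0_iff: "ip m x x = 0 \<longleftrightarrow> (\<forall>i<m. x i = 0)"
proof
  assume "ip m x x = 0"
  then show "\<forall>i<m. x i = 0" using Re_ip_self_pos[of _ m x] by fastforce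
qed (simp add: ip_def)

lemma continuous_on_ip [continuous_intros]:
  assumes "\<And>i. i < m \<Longrightarrow> continuous_on S (\<lambda>z. x z i)" "\<And>i. i < m \<Longrightarrow> continuous_on S (\<lambda>z. y z i)"
  shows "continuous_on S (\<lambda>z. ip m (x z) (y z))"
  unfolding ip_def by (intro continuous_intros assms) auto

definition nrm :: "nat \<Rightarrow> (nat \<Rightarrow> complex) \<Rightarrow> real" where
  "nrm m x = sqrt (Re (ip m x x))"

lemma nrm_pos: "\<lbrakk>i < m; x i \<noteq> 0\<rbrakk> \<Longrightarrow> 0 < nrm m x"
  by (simp add: nrm_def Re_ip_self_pos)

lemma nrm_square: "of_real ((nrm m x)\<^sup>2) = ip m x x"
proof -
  have "0 \<le> Re (ip m x x)" by (simp add: ip_self sum_nonneg)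
  then show ?thesis by (simp add: nrm_def flip: ip_self_Re)
qed

lemma ip_normalized:
  assumes "nrm m x \<noteq> 0"
  shows "ip m (\<lambda>i. x i / of_real (nrm m x)) (\<lambda>i. x i / of_real (nrm m x)) = 1"
  using assms by (simp add: ip_linear flip: nrm_square) (simp add: power2_eq_square)

lemma nrm_unit: "ip m x x = 1 \<Longrightarrow> nrm m x = 1"
  by (simp add: nrm_def)

lemma nrm_cong: "(\<And>i. i < m \<Longrightarrow> x i = y i) \<Longrightarrow> nrm m x = nrm m y"
  unfolding nrm_def by (metis ip_cong)

text \<open>The equality case of Cauchy-Schwarz: the squared norm of \<open>v + u\<close> expands to
  0. It identifies the only pairs of unit vectors at which the denominator of
  \<open>half_turn\<close> vanishes.\<close>

lemma ip_eq_minus_one: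
  assumes "ip m u u = 1" "ip m v v = 1" "ip m v u = -1" "i < m"
  shows "v i = - u i"
proof -
  have "ip m u v = -1" by (metis assms(3) cnj_ip complex_cnj_minus complex_cnj_one)
  then have "ip m (\<lambda>i. v i + u i) (\<lambda>i. v i + u i) = 0"
    using assms by (simp add: ip_linear)
  then show ?thesis using assms(4) by (simp add: ip_self_eq_0_iff add_eq_0_iff)
qed

section \<open>Unitary maps carrying one unit vector to another\<close>

text \<open>A complex Householder-type map taking the unit vector \<open>u\<close> to the unit vector \<open>v\<close>;
  it is minus the reflection in the hyperplane orthogonal to \<open>u + v\<close>, corrected by a phase.\<close>

definition half_turn :: "nat \<Rightarrow> (nat \<Rightarrow> complex) \<Rightarrow> (nat \<Rightarrow> complex) \<Rightarrow> (nat \<Rightarrow> complex) \<Rightarrow> nat \<Rightarrow> complex" where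
  "half_turn m u v x i = - x i + (u i + v i) * (ip m (\<lambda>i. u i + v i) x / (1 + ip m v u))"

text \<open>\<open>half_turn m u v\<close> alone sends \<open>u\<close> to \<open>v\<close> but acts
  as -1 on vectors orthogonal to both. Composing with \<open>half_turn m u u\<close>, which fixes
  \<open>u\<close> and negates its orthogonal complement, removes this sign, so that
  \<open>v = u\<close> gives the identity.\<close>

definition transport :: "nat \<Rightarrow> (nat \<Rightarrow> complex) \<Rightarrow> (nat \<Rightarrow> complex) \<Rightarrow> (nat \<Rightarrow> complex) \<Rightarrow> nat \<Rightarrow> complex" where
  "transport m u v x = half_turn m u v (half_turn m u u x)"

lemma ip_half_turn:
  assumes u: "ip m u u = 1" and v: "ip m v v = 1" and a: "1 + ip m v u \<noteq> 0"
  shows "ip m (half_turn m u v x) (half_turn m u v y) = ip m x y"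
proof -
  define w where "w = (\<lambda>i. u i + v i)"
  define \<alpha> where "\<alpha> = 1 + ip m v u"
  \<comment> \<open>This value is what makes \<open>1 / \<alpha>\<close> the right coefficient: the
    cross terms contribute \<open>1 / \<alpha> + 1 / cnj \<alpha>\<close>, which cancels the norm of
    \<open>w\<close> divided by \<open>\<alpha> * cnj \<alpha>\<close>.\<close>
  have ww: "ip m w w = \<alpha> + cnj \<alpha>"
    by (simp add: w_def \<alpha>_def ip_linear u v cnj_ip)
  have \<alpha>: "\<alpha> \<noteq> 0" "cnj \<alpha> \<noteq> 0" using a by (simp_all add: \<alpha>_def del: complex_cnj_add)
  have half_turn: "half_turn m u v z = (\<lambda>i. - z i + ip m w z / \<alpha> * w i)" for z
    by (auto simp: half_turn_def w_def \<alpha>_def)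
  have "ip m (half_turn m u v x) (half_turn m u v y) = ip m x y - ip m w y / \<alpha> * ip m x w
      + cnj (ip m w x / \<alpha>) * (- ip m w y + ip m w y / \<alpha> * (\<alpha> + cnj \<alpha>))"
    unfolding half_turn ip_add_left ip_add_right ip_minus_left ip_minus_right ip_scale_left ip_scale_right ww
    by (simp add: algebra_simps)
  also have "\<dots> = ip m x y"
    using \<alpha> by (simp add: cnj_ip field_simps)
  finally show ?thesis .
qed

lemma half_turn_self:
  assumes "ip m u u = 1"
  shows "half_turn m u u x i = - x i + 2 * u i * ip m u x"
  using assms by (simp add: half_turn_def ip_linear)

lemma ip_transport:
  assumes "ip m u u = 1" "ip m v v = 1" "1 + ip m v u \<noteq> 0"
  shows "ip m (transport m u v x) (transport m u v y) = ip m x y"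
  using assms by (simp add: transport_def ip_half_turn)

lemma transport_source:
  assumes u: "ip m u u = 1" and a: "1 + ip m v u \<noteq> 0"
  shows "transport m u v u i = v i"
proof -
  have "half_turn m u u u = u" using u by (auto simp: half_turn_self)
  then show ?thesis using assms by (simp add: transport_def half_turn_def ip_linear)
qed

lemma half_turn_cong:
  assumes "\<And>i. i < m \<Longrightarrow> u i = u' i" "\<And>i. i < m \<Longrightarrow> v i = v' i" "\<And>i. i < m \<Longrightarrow> x i = x' i" "i < m"
  shows "half_turn m u v x i = half_turn m u' v' x' i"
proof -
  have "ip m (\<lambda>i. u i + v i) x = ip m (\<lambda>i. u' i + v' i) x'" "ip m v u = ip m v' u'"
    using assms by (auto intro!: ip_cong)
  then show ?thesis using assms by (simp add: half_turn_def)
qed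

text \<open>For \<open>v = u\<close> the two factors coincide and \<open>half_turn m u u\<close> is
  an involution. Agreement of \<open>u\<close> and \<open>v\<close> is assumed only below
  \<open>m\<close>, hence the passage through \<open>half_turn_cong\<close>.\<close>

lemma transport_refl:
  assumes u: "ip m u u = 1" and v: "\<And>i. i < m \<Longrightarrow> v i = u i" and i: "i < m"
  shows "transport m u v x i = x i"
proof -
  have "transport m u v x i = half_turn m u u (half_turn m u u x) i"
    unfolding transport_def by (rule half_turn_cong) (use v i in auto)
  also have "half_turn m u u x = (\<lambda>i. - x i + 2 * ip m u x * u i)"
    by (auto simp: half_turn_self[OF u])
  also have "half_turn m u u \<dots> i = x i"
    unfolding half_turn_self[OF u] ip_add_right ip_minus_right ip_scale_right u by (simp add: algebra_simps)
  finally show ?thesis .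
qed

lemma transport_orthogonal:
  assumes u: "ip m u u = 1" and "ip m u x = 0" "ip m v x = 0"
  shows "transport m u v x i = x i"
  using assms by (simp add: transport_def half_turn_self[OF u, abs_def] half_turn_def ip_linear)

lemma continuous_on_half_turn:
  assumes u: "\<And>i. i < m \<Longrightarrow> continuous_on S (\<lambda>z. u z i)" and v: "\<And>i. i < m \<Longrightarrow> continuous_on S (\<lambda>z. v z i)"
    and x: "\<And>i. i < m \<Longrightarrow> continuous_on S (\<lambda>z. x z i)"
    and a: "\<And>z. z \<in> S \<Longrightarrow> 1 + ip m (v z) (u z) \<noteq> 0" and i: "i < m"
  shows "continuous_on S (\<lambda>z. half_turn m (u z) (v z) (x z) i)"
  unfolding half_turn_def by (intro continuous_intros u v x i) (use a in auto)

lemma continuous_on_transport: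
  assumes u: "\<And>i. i < m \<Longrightarrow> continuous_on S (\<lambda>z. u z i)" and v: "\<And>i. i < m \<Longrightarrow> continuous_on S (\<lambda>z. v z i)"
    and x: "\<And>i. i < m \<Longrightarrow> continuous_on S (\<lambda>z. x z i)"
    and a: "\<And>z. z \<in> S \<Longrightarrow> 1 + ip m (v z) (u z) \<noteq> 0"
    and uu: "\<And>z. z \<in> S \<Longrightarrow> ip m (u z) (u z) = 1" and i: "i < m"
  shows "continuous_on S (\<lambda>z. transport m (u z) (v z) (x z) i)"
  unfolding transport_def
  by (intro continuous_on_half_turn u v x a i) (use uu in auto)

text \<open>General position: a polynomial approximation is smooth, so its image has measure zero in
  a space of larger dimension. Some arbitrarily short vector is therefore missed, and subtracting it
  moves the map off 0.\<close>

lemma approximate_nonvanishing: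
  fixes v :: "real ^ 'd \<Rightarrow> real ^ 'e"
  assumes "compact C" "continuous_on C v" "CARD('d) < CARD('e)" "0 < \<epsilon>"
  obtains w where "continuous_on C w" "\<And>x. x \<in> C \<Longrightarrow> norm (w x - v x) < \<epsilon>" "\<And>x. x \<in> C \<Longrightarrow> w x \<noteq> 0"
proof -
  obtain p where p: "polynomial_function p" "\<And>x. x \<in> C \<Longrightarrow> norm (v x - p x) < \<epsilon>/2"
    using Stone_Weierstrass_polynomial_function[OF assms(1,2), of "\<epsilon>/2"] assms(4) by auto
  have "negligible (p ` C)"
    by (rule negligible_differentiable_image_lowdim)
       (use assms(3) p(1) in \<open>auto simp: differentiable_on_polynomial_function\<close>)
  then have "\<not> ball 0 (\<epsilon>/2) \<subseteq> p ` C"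
    using negligible_subset[of "p ` C"] open_not_negligible[of "ball (0::real^'e) (\<epsilon>/2)"] assms(4) by auto
  then obtain a where "a \<in> ball 0 (\<epsilon>/2)" and a': "a \<notin> p ` C" by blast
  then have a: "norm a < \<epsilon>/2" "a \<notin> p ` C" by auto
  show ?thesis
  proof (rule that[of "\<lambda>x. p x - a"])
    show "continuous_on C (\<lambda>x. p x - a)"
      using p(1) by (intro continuous_intros continuous_on_polymonial_function)
    show "norm (p x - a - v x) < \<epsilon>" if "x \<in> C" for x
    proof -
      have "norm (p x - a - v x) \<le> norm (v x - p x) + norm a"
        using norm_triangle_ineq4[of "p x - v x" a] by (simp add: norm_minus_commute algebra_simps)
      then show ?thesis using p(2)[OF that] a by simp
    qed
  qed (use a in auto)
qed

section \<open>Frames and cells\<close>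

text \<open>Vectors are functions on all natural numbers, of which only the values below
  \<open>m\<close> carry meaning. Statements about columns are therefore restricted to row indices
  \<open>i < m\<close>.\<close>

definition col_fun :: "complex mat \<Rightarrow> nat \<Rightarrow> nat \<Rightarrow> complex" where
  "col_fun A j = (\<lambda>i. A $$ (i, j))"

definition apply_cols :: "((nat \<Rightarrow> complex) \<Rightarrow> nat \<Rightarrow> complex) \<Rightarrow> complex mat \<Rightarrow> complex mat" where
  "apply_cols T A = Matrix.mat (dim_row A) (dim_col A) (\<lambda>(i, j). T (col_fun A j) i)"

lemma col_fun_apply: "col_fun A j i = A $$ (i, j)"
  by (simp add: col_fun_def)

lemma stiefel_iff:
  "A \<in> stiefel m n \<longleftrightarrow> A \<in> carrier_mat m n \<and>
     (\<forall>j<n. \<forall>l<n. ip m (col_fun A j) (col_fun A l) = (if j = l then 1 else 0))"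
proof (cases "A \<in> carrier_mat m n")
  case True
  have "(mat_adjoint A * A) $$ (j, l) = ip m (col_fun A j) (col_fun A l)" if "j < n" "l < n" for j l
  proof -
    have "(mat_adjoint A * A) $$ (j, l) = conjugate (Matrix.col A j) \<bullet> Matrix.col A l"
      using that True by (simp add: mat_adjoint_def)
    also have "\<dots> = ip m (col_fun A j) (col_fun A l)"
      using that True by (simp add: scalar_prod_def ip_def col_fun_def atLeast0LessThan)
    finally show ?thesis .
  qed
  moreover have "mat_adjoint A * A \<in> carrier_mat n n"
    using True by (auto simp: mat_adjoint_def)
  ultimately have "mat_adjoint A * A = 1\<^sub>m n \<longleftrightarrow>
      (\<forall>j<n. \<forall>l<n. ip m (col_fun A j) (col_fun A l) = (if j = l then 1 else 0))"
    by (simp only: mat_eq_iff carrier_matD index_one_mat) (metis carrier_matD index_one_mat(1))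
  with True show ?thesis
    by (simp add: stiefel_def)
qed (simp add: stiefel_def)

lemma stiefel_carrier: "A \<in> stiefel m n \<Longrightarrow> A \<in> carrier_mat m n"
  by (simp add: stiefel_def)

lemma col_fun_apply_cols:
  assumes "A \<in> carrier_mat m n" "i < m" "j < n"
  shows "col_fun (apply_cols T A) j i = T (col_fun A j) i"
  using assms by (simp add: col_fun_def apply_cols_def)

lemma apply_cols_carrier: "A \<in> carrier_mat m n \<Longrightarrow> apply_cols T A \<in> carrier_mat m n"
  by (simp add: apply_cols_def)

lemma apply_cols_stiefel:
  assumes A: "A \<in> stiefel m n" and T: "\<And>x y. ip m (T x) (T y) = ip m x y"
  shows "apply_cols T A \<in> stiefel m n"
proof -
  have "ip m (col_fun (apply_cols T A) j) (col_fun (apply_cols T A) l) = ip m (T (col_fun A j)) (T (col_fun A l))"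
    if "j < n" "l < n" for j l
    using that stiefel_carrier[OF A] by (intro ip_cong) (auto simp: col_fun_apply_cols)
  then show ?thesis
    using A by (simp add: stiefel_iff T apply_cols_carrier)
qed

lemma apply_cols_id:
  assumes A: "A \<in> carrier_mat m n" and T: "\<And>x i. i < m \<Longrightarrow> T x i = x i"
  shows "apply_cols T A = A"
  by (rule eq_matI) (use A in \<open>auto simp: apply_cols_def T col_fun_def\<close>)

lemma canonical_frame_carrier: "canonical_frame m n \<in> carrier_mat m n"
  by (simp add: canonical_frame_def)

lemma col_fun_canonical_frame:
  "i < m \<Longrightarrow> j < n \<Longrightarrow> col_fun (canonical_frame m n) j i = basis_vec j i"
  by (simp add: canonical_frame_def col_fun_def basis_vec_def)

text \<open>Orthogonality to a column that is already a basis vector kills the corresponding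
  coordinate. After \<open>c\<close> columns are fixed, the next one lives in the last
  \<open>m - c\<close> complex coordinates.\<close>

lemma stiefel_column_eq_0:
  assumes A: "A \<in> stiefel m n" and "c < n" "j < n" "j < m" "j \<noteq> c"
    and "\<And>i. i < m \<Longrightarrow> col_fun A j i = basis_vec j i"
  shows "col_fun A c j = 0"
proof -
  have "ip m (col_fun A j) (col_fun A c) = ip m (basis_vec j) (col_fun A c)"
    using assms by (intro ip_cong) auto
  moreover have "ip m (col_fun A j) (col_fun A c) = 0"
    using assms by (simp add: stiefel_iff)
  ultimately show ?thesis using assms by (simp add: ip_basis_left)
qed

lemma canonical_frame_stiefel: "n \<le> m \<Longrightarrow> canonical_frame m n \<in> stiefel m n"
proof -
  assume "n \<le> m"
  have "ip m (col_fun (canonical_frame m n) j) (col_fun (canonical_frame m n) l) = ip m (basis_vec j) (basis_vec l)"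
    if "j < n" "l < n" for j l
    using that by (intro ip_cong) (auto simp: col_fun_canonical_frame)
  then show ?thesis
    using \<open>n \<le> m\<close> by (auto simp: stiefel_iff canonical_frame_carrier ip_basis_left basis_vec_def)
qed

lemma eq_canonical_frameI:
  assumes "A \<in> carrier_mat m n" "\<And>i j. i < m \<Longrightarrow> j < n \<Longrightarrow> col_fun A j i = basis_vec j i"
  shows "A = canonical_frame m n"
  by (rule eq_matI) (use assms in \<open>auto simp: canonical_frame_def col_fun_def basis_vec_def\<close>)

section \<open>The topology of matrices and frames, entry by entry\<close>

lemma topspace_mat_topology: "topspace (mat_topology m n) = carrier_mat m n"
  by (auto simp: mat_topology_def topspace_pullback_topology)

lemma topspace_stiefel_topology: "topspace (stiefel_topology m n) = stiefel m n"
  by (auto simp: stiefel_topology_def topspace_mat_topology stiefel_def)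

lemma continuous_map_mat_topology:
  "continuous_map X (mat_topology m n) f \<longleftrightarrow>
     (\<forall>x\<in>topspace X. f x \<in> carrier_mat m n) \<and>
     (\<forall>i<m. \<forall>j<n. continuous_map X euclidean (\<lambda>x. f x $$ (i, j)))" (is "?L \<longleftrightarrow> ?R")
proof
  let ?r = "\<lambda>A::complex mat. restrict (\<lambda>ij. A $$ ij) ({..<m} \<times> {..<n})"
  let ?P = "product_topology (\<lambda>_. euclidean :: complex topology) ({..<m} \<times> {..<n})"
  have proj: "continuous_map (mat_topology m n) ?P ?r"
    using continuous_map_pullback[OF continuous_map_id, of "carrier_mat m n" ?r ?P] by (simp add: mat_topology_def)
  {
    assume L: ?L
    have "continuous_map X ?P (?r \<circ> f)" by (rule continuous_map_compose[OF L proj])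
    then have "\<forall>k\<in>{..<m} \<times> {..<n}. continuous_map X euclidean (\<lambda>x. (?r \<circ> f) x k)"
      by (simp add: continuous_map_componentwise)
    then show ?R
      using L by (auto simp: continuous_map_def topspace_mat_topology)
  next
    assume R: ?R
    have "continuous_map X ?P (?r \<circ> f)"
      using R by (auto simp: continuous_map_componentwise)
    then show ?L
      unfolding mat_topology_def by (rule continuous_map_pullback') (use R in auto)
  }
qed

lemma continuous_map_stiefel_topology:
  "continuous_map X (stiefel_topology m n) f \<longleftrightarrow>
     (\<forall>x\<in>topspace X. f x \<in> stiefel m n) \<and>
     (\<forall>i<m. \<forall>j<n. continuous_map X euclidean (\<lambda>x. f x $$ (i, j)))"
  by (auto simp: stiefel_topology_def continuous_map_in_subtopology continuous_map_mat_topology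
      stiefel_carrier image_subset_iff_funcset)

section \<open>The cube, its boundary and its coordinate cells\<close>

lemma mem_cube_iff: "k \<in> cube \<longleftrightarrow> (\<forall>i. \<bar>k $ i\<bar> \<le> pi)"
  by (auto simp: cube_def mem_box_cart abs_le_iff minus_le_iff)

lemma mem_frontier_cube_iff: "k \<in> frontier cube \<longleftrightarrow> k \<in> cube \<and> (\<exists>i. \<bar>k $ i\<bar> = pi)"
proof -
  have "k \<in> frontier cube \<longleftrightarrow> k \<in> cube \<and> \<not> (\<forall>i. \<bar>k $ i\<bar> < pi)"
    unfolding cube_def frontier_cbox Diff_iff by (simp add: mem_box_cart abs_less_iff minus_less_iff conj_commute)
  then show ?thesis by (simp add: mem_cube_iff not_less) (metis order_antisym order_refl)
qed

lemma compact_cube: "compact cube"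
  by (simp add: cube_def)

lemma uminus_cube: "- k \<in> cube \<longleftrightarrow> k \<in> cube"
  by (simp add: mem_cube_iff)

lemma uminus_frontier_cube: "- k \<in> frontier cube \<longleftrightarrow> k \<in> frontier cube"
  by (simp add: mem_frontier_cube_iff uminus_cube)

lemma frontier_cube_subset: "frontier cube \<subseteq> cube"
  by (auto simp: mem_frontier_cube_iff)

definition cell :: "'d set \<Rightarrow> (real ^ 'd) set" where
  "cell S = {k \<in> cube. \<forall>i. i \<notin> S \<longrightarrow> k $ i = 0}"

text \<open>A closed half of \<open>cell (insert a S)\<close>; together with its mirror image it
  covers that cell. For \<open>a\<close> outside \<open>S\<close> the two halves meet exactly in
  \<open>cell S\<close>, where the map is already constant when this is used.\<close>

definition half_cell :: "'d set \<Rightarrow> 'd \<Rightarrow> (real ^ 'd) set" where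
  "half_cell S a = {k \<in> cell (insert a S). 0 \<le> k $ a}"

definition cell_proj :: "'d set \<Rightarrow> real ^ 'd \<Rightarrow> real ^ 'd" where
  "cell_proj S k = (\<chi> i. if i \<in> S then k $ i else 0)"

text \<open>The damping factor for extending a homotopy from a cell to the cube: 1 on
  \<open>cell S\<close>, and 0 as soon as a coordinate outside \<open>S\<close> reaches the
  boundary.\<close>

definition cell_cutoff :: "'d set \<Rightarrow> real ^ 'd \<Rightarrow> real" where
  "cell_cutoff S k = (\<Prod>i\<in>-S. 1 - \<bar>k $ i\<bar> / pi)"

lemma cell_empty: "cell {} = {0}"
  by (auto simp: cell_def mem_cube_iff Finite_Cartesian_Product.vec_eq_iff)

lemma cell_UNIV: "cell UNIV = cube"
  by (simp add: cell_def)

lemma half_cell_subset: "half_cell S a \<subseteq> cell (insert a S)" "half_cell S a \<subseteq> cube"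
  by (auto simp: half_cell_def cell_def)

lemma compact_half_cell: "compact (half_cell S a)"
proof -
  have "half_cell S a = cube \<inter> (\<Inter>i\<in>-insert a S. {k. k $ i = 0}) \<inter> {k. 0 \<le> k $ a}"
    by (auto simp: half_cell_def cell_def)
  moreover have "closed {k :: real ^ 'a. k $ i = 0}" "closed {k :: real ^ 'a. 0 \<le> k $ i}" for i
    by (intro closed_Collect_eq closed_Collect_le continuous_intros)+
  ultimately show ?thesis
    by (simp add: compact_Int_closed compact_cube closed_INT)
qed

lemma cell_proj_half_cell: "k \<in> cube \<Longrightarrow> 0 \<le> k $ a \<Longrightarrow> cell_proj (insert a S) k \<in> half_cell S a"
  by (auto simp: half_cell_def cell_def cell_proj_def mem_cube_iff)

lemma cell_proj_id: "k \<in> cell S \<Longrightarrow> cell_proj S k = k"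
  by (auto simp: cell_def cell_proj_def Finite_Cartesian_Product.vec_eq_iff)

lemma cell_cutoff_one: "k \<in> cell S \<Longrightarrow> cell_cutoff S k = 1"
  by (auto simp: cell_def cell_cutoff_def)

lemma cell_cutoff_range: "k \<in> cube \<Longrightarrow> cell_cutoff S k \<in> {0..1}"
  by (auto simp: cell_cutoff_def mem_cube_iff intro!: prod_nonneg prod_le_1)

lemma cell_cutoff_uminus: "cell_cutoff S (- k) = cell_cutoff S k"
  by (simp add: cell_cutoff_def)

text \<open>This is why the damped extension stays at the base point on the boundary: either the
  projected point lies on the boundary, where the homotopy is stationary, or the time is damped to
  0.\<close>

lemma frontier_cube_cases:
  assumes "k \<in> frontier cube"
  shows "cell_proj S k \<in> frontier cube \<or> cell_cutoff S k = 0"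
proof -
  obtain i where i: "\<bar>k $ i\<bar> = pi" and k: "k \<in> cube" using assms by (auto simp: mem_frontier_cube_iff)
  show ?thesis
  proof (cases "i \<in> S")
    case True
    then show ?thesis using i k
      by (auto simp: mem_frontier_cube_iff mem_cube_iff cell_proj_def intro!: exI[of _ i])
  next
    case False
    then show ?thesis using i by (auto simp: cell_cutoff_def intro!: prod_zero bexI[of _ i])
  qed
qed

lemma continuous_on_cell_proj [continuous_intros]: "continuous_on X (cell_proj S)"
proof -
  have "continuous_on X (\<lambda>k. if i \<in> S then k $ i else 0)" for i
    by (cases "i \<in> S") (auto intro!: continuous_intros)
  then show ?thesis
    unfolding cell_proj_def[abs_def] by (intro continuous_on_vec_lambda)
qed

lemma continuous_on_cell_cutoff [continuous_intros]: "continuous_on X (cell_cutoff S)"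
  unfolding cell_cutoff_def[abs_def] by (intro continuous_intros) auto

section \<open>Deforming a column over a half cell\<close>

text \<open>Common setting of both symmetry classes. The deformation over the half cells depends on
  the action only through these properties; its particular form enters when the value at the origin
  is moved.\<close>

locale frame_involution =
  fixes m n :: nat and g :: "complex mat \<Rightarrow> complex mat"
  assumes n_le_m: "n \<le> m"
    and continuous_g: "continuous_map (stiefel_topology m n) (stiefel_topology m n) g"
    and g_g: "A \<in> stiefel m n \<Longrightarrow> g (g A) = A"
    and g_canonical: "g (canonical_frame m n) = canonical_frame m n"
begin

abbreviation "frame0 \<equiv> canonical_frame m n"
abbreviation "V \<equiv> stiefel m n"
abbreviation "TV \<equiv> stiefel_topology m n"

definition equiv_homotopic :: "(real ^ 'd \<Rightarrow> complex mat) \<Rightarrow> (real ^ 'd \<Rightarrow> complex mat) \<Rightarrow> bool" (infix "\<simeq>" 50) where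
  "f \<simeq> f' \<longleftrightarrow> homotopic_with (equivariant_pair_map g frame0) (top_of_set cube) TV f f'"

lemma g_stiefel: "A \<in> V \<Longrightarrow> g A \<in> V"
  using continuous_map_image_subset_topspace[OF continuous_g] by (auto simp: topspace_stiefel_topology)

text \<open>The congruence under which \<open>homotopic_with\<close> may be described by a homotopy
  given on the cube only: the condition does not see values off the cube.\<close>

lemma equivariant_pair_map_cong:
  assumes "\<And>k. k \<in> topspace (top_of_set cube) \<Longrightarrow> f k = f' k"
  shows "equivariant_pair_map g x0 f \<longleftrightarrow> equivariant_pair_map g x0 f'"
proof -
  have "f ` frontier cube = f' ` frontier cube"
    using assms frontier_cube_subset by (intro image_cong) (auto simp: subset_iff)
  moreover have "(\<forall>k\<in>cube. f (- k) = g (f k)) \<longleftrightarrow> (\<forall>k\<in>cube. f' (- k) = g (f' k))"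
    using assms by (simp add: uminus_cube)
  ultimately show ?thesis by (simp add: equivariant_pair_map_def)
qed

lemma equivariant_maps_iff:
  "f \<in> equivariant_maps TV g frame0 \<longleftrightarrow>
     (\<forall>k\<in>cube. f k \<in> V) \<and> (\<forall>i<m. \<forall>j<n. continuous_on cube (\<lambda>k. f k $$ (i, j))) \<and>
     (\<forall>k\<in>frontier cube. f k = frame0) \<and> (\<forall>k\<in>cube. f (- k) = g (f k))"
  by (auto simp: equivariant_maps_def equivariant_pair_map_def continuous_map_stiefel_topology)

lemma equiv_homotopic_maps:
  assumes "f \<simeq> f'"
  shows "f \<in> equivariant_maps TV g frame0" "f' \<in> equivariant_maps TV g frame0"
  using homotopic_with_imp_continuous_maps homotopic_with_imp_property assms
  unfolding equiv_homotopic_def equivariant_maps_def by blast+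

lemma equiv_homotopicI:
  fixes H :: "real \<Rightarrow> real ^ 'd \<Rightarrow> complex mat"
  assumes V: "\<And>t k. t \<in> {0..1} \<Longrightarrow> k \<in> cube \<Longrightarrow> H t k \<in> V"
    and cont: "\<And>i j. i < m \<Longrightarrow> j < n \<Longrightarrow> continuous_on ({0..1} \<times> cube) (\<lambda>z. H (fst z) (snd z) $$ (i, j))"
    and bd: "\<And>t k. t \<in> {0..1} \<Longrightarrow> k \<in> frontier cube \<Longrightarrow> H t k = frame0"
    and eq: "\<And>t k. t \<in> {0..1} \<Longrightarrow> k \<in> cube \<Longrightarrow> H t (- k) = g (H t k)"
    and H0: "\<And>k. k \<in> cube \<Longrightarrow> H 0 k = f k" and H1: "\<And>k. k \<in> cube \<Longrightarrow> H 1 k = f' k"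
  shows "f \<simeq> f'"
proof -
  have "continuous_map (top_of_set ({0..1} \<times> cube)) TV (\<lambda>z. H (fst z) (snd z))"
    using V cont by (auto simp: continuous_map_stiefel_topology)
  moreover have "equivariant_pair_map g frame0 (H t)" if "t \<in> {0..1}" for t
    using bd eq that by (auto simp: equivariant_pair_map_def)
  ultimately show ?thesis
    unfolding equiv_homotopic_def
    by (subst homotopic_with[OF equivariant_pair_map_cong])
       (auto intro: H0 H1 intro!: exI[of _ "\<lambda>z. H (fst z) (snd z)"])
qed

lemma equiv_homotopic_trans [trans]: "f \<simeq> f' \<Longrightarrow> f' \<simeq> f'' \<Longrightarrow> f \<simeq> f''"
  unfolding equiv_homotopic_def by (rule homotopic_with_trans)

lemma equiv_homotopic_sym: "f \<simeq> f' \<Longrightarrow> f' \<simeq> f"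
  unfolding equiv_homotopic_def by (rule homotopic_with_symD)

lemma equiv_homotopic_refl: "f \<in> equivariant_maps TV g frame0 \<Longrightarrow> f \<simeq> f"
  unfolding equiv_homotopic_def equivariant_maps_def by simp

lemma equiv_homotopic_const:
  assumes f: "f \<in> equivariant_maps TV g frame0" and "\<And>k. k \<in> cube \<Longrightarrow> f k = frame0"
  shows "f \<simeq> (\<lambda>_. frame0)"
  using assms by (intro equiv_homotopicI[where H = "\<lambda>t. f"])
    (auto simp: equivariant_maps_iff intro!: continuous_on_compose2[of cube _ _ snd] continuous_intros)

text \<open>The normalised straight segment from column \<open>c\<close> to \<open>p\<close> is
  lifted to frames by \<open>transport\<close>. By \<open>not_neg\<close> the segment avoids 0 and
  the opposite of the column, by \<open>supp\<close> the earlier columns stay orthogonal to the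
  motion, and by \<open>bd\<close> nothing moves where \<open>f\<close> already has the base
  value.\<close>

lemma move_column:
  fixes f :: "real ^ 'd \<Rightarrow> complex mat"
  assumes f: "f \<in> equivariant_maps TV g frame0"
    and fS: "\<And>k. k \<in> cell S \<Longrightarrow> f k = frame0" and a: "a \<notin> S" and c: "c < n"
    and cols: "\<And>k i j. k \<in> half_cell S a \<Longrightarrow> j < c \<Longrightarrow> i < m \<Longrightarrow> col_fun (f k) j i = basis_vec j i"
    and cont_p: "\<And>i. i < m \<Longrightarrow> continuous_on (half_cell S a) (\<lambda>k. p k i)"
    and supp: "\<And>k i. k \<in> half_cell S a \<Longrightarrow> i < c \<Longrightarrow> p k i = 0"
    and not_neg: "\<And>k r. k \<in> half_cell S a \<Longrightarrow> 0 \<le> r \<Longrightarrow> \<exists>i<m. p k i \<noteq> - of_real r * col_fun (f k) c i"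
    and bd: "\<And>k i. k \<in> half_cell S a \<Longrightarrow> k \<in> frontier cube \<or> k $ a = 0 \<Longrightarrow> i < m \<Longrightarrow> p k i = basis_vec c i"
  obtains f' where "f \<simeq> f'" "\<And>k. k \<in> cell S \<Longrightarrow> f' k = frame0"
    "\<And>k i j. k \<in> half_cell S a \<Longrightarrow> j < c \<Longrightarrow> i < m \<Longrightarrow> col_fun (f' k) j i = basis_vec j i"
    "\<And>k i. k \<in> half_cell S a \<Longrightarrow> i < m \<Longrightarrow> col_fun (f' k) c i = p k i / of_real (nrm m (p k))"
proof -
  define C where "C = half_cell S a"
  define P where "P = cell_proj (insert a S)"
  define \<psi> where "\<psi> = cell_cutoff (insert a S)"
  define u where "u k = col_fun (f k) c" for k
  define q where "q s k i = (1 - of_real s) * u k i + of_real s * p k i" for s k i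
  define v where "v s k i = q s k i / of_real (nrm m (q s k))" for s k i
  \<comment> \<open>The homotopy is read off at the projected point \<open>P k\<close>, with time
    damped by \<open>\<psi>\<close>. Away from the half cell \<open>u (P k)\<close> need not be a
    column of \<open>f k\<close>, but a unitary map still takes frames to frames.\<close>
  define G where "G s k = apply_cols (transport m (u (P k)) (v (s * \<psi> k) (P k))) (f k)" for s k
  \<comment> \<open>Equivariance dictates the values on the opposite half of the cube.\<close>
  define F where "F s k = (if 0 \<le> k $ a then G s k else g (G s (- k)))" for s k

  have fV: "f k \<in> V" "f k \<in> carrier_mat m n" if "k \<in> cube" for k
    using f that by (auto simp: equivariant_maps_iff stiefel_carrier)
  have f_cont: "continuous_on cube (\<lambda>k. f k $$ (i, j))" if "i < m" "j < n" for i j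
    using f that by (auto simp: equivariant_maps_iff)
  have f_eq: "f (- k) = g (f k)" if "k \<in> cube" for k
    using f that by (auto simp: equivariant_maps_iff)
  have f_bd: "f k = frame0" if "k \<in> frontier cube" for k
    using f that by (auto simp: equivariant_maps_iff)
  have C_cube: "C \<subseteq> cube" by (simp add: C_def half_cell_subset)
  have c_m: "c < m" using c n_le_m by simp

  have uu: "ip m (u k) (u k) = 1" if "k \<in> cube" for k
    using fV(1)[OF that] c by (simp add: u_def stiefel_iff)
  have q_nz: "\<exists>i<m. q s k i \<noteq> - of_real r * u k i"
    if k: "k \<in> C" and s: "s \<in> {0..1}" and l: "0 \<le> r" for s k r
  proof (rule ccontr)
    assume "\<not> ?thesis"
    \<comment> \<open>For \<open>s = 0\<close> this relation forces \<open>u k = 0\<close>,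
      contradicting unit length; for positive \<open>s\<close> it makes \<open>p k\<close> a
      nonpositive multiple of the column, contradicting \<open>not_neg\<close>.\<close>
    then have q: "of_real s * p k i = - of_real (r + (1 - s)) * u k i" if "i < m" for i
      using that by (auto simp: q_def algebra_simps)
    show False
    proof (cases "s = 0")
      case True
      have "u k i = 0" if "i < m" for i
      proof -
        have "- of_real (r + 1) * u k i = 0" using q[OF that] True by simp
        moreover have "- of_real (r + 1) \<noteq> (0::complex)"
          using l of_real_eq_0_iff[of "r + 1", where 'a = complex] by (simp del: of_real_eq_0_iff of_real_add)
        ultimately show ?thesis using mult_eq_0_iff by blast
      qed
      then have "ip m (u k) (u k) = 0" by (simp add: ip_self_eq_0_iff)
      then show False using uu k C_cube by auto
    next
      case False
      have "p k i = - of_real ((r + (1 - s)) / s) * u k i" if "i < m" for i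
        using q[OF that] False by (simp add: field_simps)
      moreover have "0 \<le> (r + (1 - s)) / s" using s l by auto
      ultimately show False using not_neg[of k "(r + (1 - s)) / s"] k by (auto simp: C_def u_def)
    qed
  qed
  have q_pos: "0 < nrm m (q s k)" if "k \<in> C" "s \<in> {0..1}" for s k
  proof -
    have "\<exists>i<m. q s k i \<noteq> 0" using q_nz[OF that, of 0] by simp
    then obtain i where "i < m" "q s k i \<noteq> 0" by blast
    then show ?thesis by (rule nrm_pos)
  qed
  have vv: "ip m (v s k) (v s k) = 1" if "k \<in> C" "s \<in> {0..1}" for s k
    using ip_normalized[of m "q s k"] q_pos[OF that] by (simp add: v_def[abs_def])
  have vu: "1 + ip m (v s k) (u k) \<noteq> 0" if "k \<in> C" "s \<in> {0..1}" for s k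
  proof
    assume "1 + ip m (v s k) (u k) = 0"
    then have "v s k i = - u k i" if "i < m" for i
      using ip_eq_minus_one[of m "u k" "v s k" i] uu[of k] vv[of k s] that \<open>k \<in> C\<close> \<open>s \<in> {0..1}\<close> C_cube
      by (auto simp: add_eq_0_iff)
    then have "q s k i = - of_real (nrm m (q s k)) * u k i" if "i < m" for i
      using that q_pos[OF \<open>k \<in> C\<close> \<open>s \<in> {0..1}\<close>] by (simp add: v_def field_simps)
    then show False
      using q_nz[OF that, of "nrm m (q s k)"] q_pos[OF that] by auto
  qed
  have v_eq_u: "v s k i = u k i" if "k \<in> C" and sk: "s = 0 \<or> k \<in> frontier cube \<or> k $ a = 0" and "i < m" for s k i
  proof -
    have "q s k j = u k j" if j: "j < m" for j
    proof (cases "s = 0")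
      case False
      then have fr: "k \<in> frontier cube \<or> k $ a = 0" using sk by auto
      then have "f k = frame0"
        using f_bd fS[of k] \<open>k \<in> C\<close> by (fastforce simp: C_def half_cell_def cell_def)
      then have "u k j = basis_vec c j" using j c by (simp add: u_def col_fun_canonical_frame)
      then show ?thesis using bd[of k j] fr \<open>k \<in> C\<close> j by (simp add: q_def C_def algebra_simps)
    qed (simp add: q_def)
    then show ?thesis
      using \<open>i < m\<close> nrm_cong[of m "q s k" "u k"] nrm_unit[OF uu] \<open>k \<in> C\<close> C_cube by (auto simp: v_def)
  qed

  have PC: "P k \<in> C" if "k \<in> cube" "0 \<le> k $ a" for k
    using that by (simp add: P_def C_def cell_proj_half_cell)
  have Pcube: "P k \<in> cube" if "k \<in> cube" "0 \<le> k $ a" for k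
    using PC[OF that] C_cube by auto
  have s\<psi>: "s * \<psi> k \<in> {0..1}" if "s \<in> {0..1}" "k \<in> cube" for s k
    using cell_cutoff_range[OF that(2), of "insert a S"] that(1) by (auto simp: \<psi>_def mult_le_one)
  have G_V: "G s k \<in> V" if "s \<in> {0..1}" "k \<in> cube" "0 \<le> k $ a" for s k
    unfolding G_def using that
    by (intro apply_cols_stiefel fV ip_transport uu vv vu Pcube PC s\<psi>)
  have G_id: "G s k = f k" if "k \<in> cube" "0 \<le> k $ a" "s = 0 \<or> k \<in> frontier cube \<or> k $ a = 0" for s k
  proof -
    have "s * \<psi> k = 0 \<or> P k \<in> frontier cube \<or> P k $ a = 0"
      using that(3) frontier_cube_cases[of k "insert a S"] by (auto simp: P_def \<psi>_def cell_proj_def)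
    then show ?thesis
      unfolding G_def using that
      by (intro apply_cols_id[OF fV(2)] transport_refl uu v_eq_u PC Pcube)
  qed
  have F_V: "F s k \<in> V" if "s \<in> {0..1}" "k \<in> cube" for s k
    using that G_V[of s k] G_V[of s "-k"] by (auto simp: F_def g_stiefel uminus_cube)
  \<comment> \<open>On the wall \<open>k $ a = 0\<close> nothing moves, so both formulas give
    \<open>f k\<close>. The second one thus holds on a closed half, as needed for equivariance and
    for pasting.\<close>
  have F_neg: "F s k = g (G s (- k))" if "s \<in> {0..1}" "k \<in> cube" "k $ a \<le> 0" for s k
    using that G_id[of k s] G_id[of "-k" s] f_eq[of "-k"] by (auto simp: F_def uminus_cube)
  have F_eq: "F s (- k) = g (F s k)" if "s \<in> {0..1}" "k \<in> cube" for s k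
    using that F_neg[of s k] F_neg[of s "-k"] g_g[OF G_V[of s "-k"]]
    by (cases "0 \<le> k $ a") (auto simp: F_def uminus_cube)
  have F_bd: "F s k = frame0" if "s \<in> {0..1}" "k \<in> frontier cube" for s k
    using that G_id[of k s] G_id[of "-k" s] frontier_cube_subset f_bd[of k] f_bd[of "-k"]
    by (auto simp: F_def g_canonical uminus_frontier_cube uminus_cube)
  have F_0: "F 0 k = f k" if "k \<in> cube" for k
    using that G_id[of k 0] G_id[of "-k" 0] f_eq[of "-k"] by (auto simp: F_def uminus_cube)

  define X where "X = {0..1::real} \<times> {k \<in> cube. 0 \<le> k $ a}"
  have P_cont: "continuous_on X (\<lambda>z. h (P (snd z)))" if "continuous_on C h" for h :: "real ^ 'd \<Rightarrow> complex"
    unfolding P_def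
    by (rule continuous_on_compose2[OF that])
       (use PC in \<open>auto simp: X_def P_def intro!: continuous_on_compose2[OF continuous_on_cell_proj] continuous_intros\<close>)
  have u_cont: "continuous_on X (\<lambda>z. u (P (snd z)) i)" if "i < m" for i
    unfolding u_def col_fun_apply
    by (intro P_cont continuous_on_subset[OF f_cont[OF that c] C_cube])
  have p_cont: "continuous_on X (\<lambda>z. p (P (snd z)) i)" if "i < m" for i
    by (intro P_cont cont_p[folded C_def] that)
  have \<psi>_cont: "continuous_on X (\<lambda>z. \<psi> (snd z))"
    unfolding \<psi>_def by (intro continuous_on_compose2[OF continuous_on_cell_cutoff] continuous_intros) auto
  have q_cont: "continuous_on X (\<lambda>z. q (fst z * \<psi> (snd z)) (P (snd z)) i)" if "i < m" for i
    unfolding q_def by (intro continuous_intros u_cont p_cont \<psi>_cont that)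
  have v_cont: "continuous_on X (\<lambda>z. v (fst z * \<psi> (snd z)) (P (snd z)) i)" if "i < m" for i
    unfolding v_def nrm_def
  proof (intro continuous_intros q_cont that)
    show "\<forall>z\<in>X. complex_of_real (sqrt (Re (ip m (q (fst z * \<psi> (snd z)) (P (snd z)))
      (q (fst z * \<psi> (snd z)) (P (snd z)))))) \<noteq> 0"
      using q_pos[OF PC s\<psi>] unfolding X_def nrm_def by (metis (no_types, lifting) mem_Collect_eq mem_Sigma_iff of_real_eq_0_iff order_less_irrefl prod.collapse)
  qed
  have G_cont: "continuous_on X (\<lambda>z. G (fst z) (snd z) $$ (i, j))" if "i < m" "j < n" for i j
  proof -
    have "continuous_on X (\<lambda>z. transport m (u (P (snd z))) (v (fst z * \<psi> (snd z)) (P (snd z))) (col_fun (f (snd z)) j) i)"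
      unfolding col_fun_def
    proof (intro continuous_on_transport u_cont v_cont continuous_on_compose2[OF f_cont, of _ _ X snd] continuous_intros that)
      show "1 + ip m (v (fst z * \<psi> (snd z)) (P (snd z))) (u (P (snd z))) \<noteq> 0" if "z \<in> X" for z
        using that by (intro vu PC s\<psi>) (auto simp: X_def)
      show "ip m (u (P (snd z))) (u (P (snd z))) = 1" if "z \<in> X" for z
        using that by (intro uu Pcube) (auto simp: X_def)
    qed (auto simp: X_def)
    moreover have "G (fst z) (snd z) $$ (i, j) = transport m (u (P (snd z))) (v (fst z * \<psi> (snd z)) (P (snd z))) (col_fun (f (snd z)) j) i"
      if "z \<in> X" for z
      unfolding G_def using that \<open>i < m\<close> \<open>j < n\<close> col_fun_apply_cols[OF fV(2)] by (auto simp: X_def col_fun_def)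
    ultimately show ?thesis by (simp cong: continuous_on_cong)
  qed
  have gG_cont: "continuous_on ({0..1} \<times> {k \<in> cube. k $ a \<le> 0}) (\<lambda>z. g (G (fst z) (- snd z)) $$ (i, j))"
    if "i < m" "j < n" for i j
  proof -
    let ?Y = "{0..1::real} \<times> {k \<in> cube. k $ a \<le> 0}"
    have "continuous_on ?Y (\<lambda>z. G (fst z) (- snd z) $$ (i, j))" if "i < m" "j < n" for i j
    proof -
      have "continuous_on ?Y (\<lambda>z. (fst z, - snd z))" "(\<lambda>z. (fst z, - snd z)) ` ?Y \<subseteq> X"
        by (auto simp: X_def uminus_cube intro!: continuous_intros)
      from continuous_on_compose2[OF G_cont[OF that] this] show ?thesis by simp
    qed
    then have "continuous_map (top_of_set ?Y) TV (\<lambda>z. G (fst z) (- snd z))"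
      using G_V by (auto simp: continuous_map_stiefel_topology uminus_cube)
    from continuous_map_compose[OF this continuous_g] show ?thesis
      using that by (auto simp: continuous_map_stiefel_topology o_def)
  qed
  have F_cont: "continuous_on ({0..1} \<times> cube) (\<lambda>z. F (fst z) (snd z) $$ (i, j))" if "i < m" "j < n" for i j
  proof -
    let ?Y = "{0..1::real} \<times> {k \<in> cube. k $ a \<le> 0}"
    have XY: "{0..1} \<times> cube = X \<union> ?Y" by (auto simp: X_def)
    have cl: "closed {k \<in> cube. 0 \<le> k $ a}" "closed {k \<in> cube. k $ a \<le> 0}"
      using compact_imp_closed[OF compact_cube]
      by (auto simp: Collect_conj_eq intro!: closed_Int closed_Collect_le continuous_intros)
    show ?thesis
      unfolding XY
    proof (rule continuous_on_closed_Un)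
      show "closed X" "closed ?Y" using cl by (auto simp: X_def closed_Times)
      show "continuous_on X (\<lambda>z. F (fst z) (snd z) $$ (i, j))"
        using G_cont[OF that] by (rule continuous_on_eq) (auto simp: X_def F_def)
      show "continuous_on ?Y (\<lambda>z. F (fst z) (snd z) $$ (i, j))"
        using gG_cont[OF that] by (rule continuous_on_eq) (auto simp: F_neg)
    qed
  qed

  have F1: "F 1 k = apply_cols (transport m (u k) (v 1 k)) (f k)" if "k \<in> C" for k
  proof -
    have "0 \<le> k $ a" "P k = k" "\<psi> k = 1"
      using that by (auto simp: C_def half_cell_def P_def \<psi>_def cell_proj_id cell_cutoff_one)
    then show ?thesis by (simp add: F_def G_def)
  qed
  show ?thesis
  proof (rule that[of "F 1"])
    show "f \<simeq> F 1"
      using F_V F_cont F_bd F_eq F_0 by (intro equiv_homotopicI[where H = F]) auto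
    show "F 1 k = frame0" if "k \<in> cell S" for k
      using that a fS[OF that] G_id[of k 1] by (auto simp: cell_def F_def)
    show "col_fun (F 1 k) j i = basis_vec j i" if "k \<in> half_cell S a" "j < c" "i < m" for k i j
    proof -
      have k: "k \<in> C" "k \<in> cube" using that C_cube by (auto simp: C_def)
      have j: "j < m" "j < n" using that c_m c by auto
      \<comment> \<open>Column \<open>j\<close> is the basis vector \<open>j\<close>, so a vector is
        orthogonal to it exactly when its coordinate \<open>j\<close> vanishes. This holds for both
        endpoints of the transport, which hence fixes column \<open>j\<close>.\<close>
      have uj: "u k j = 0"
        unfolding u_def using stiefel_column_eq_0[OF fV(1)[OF k(2)] c j(2,1)] cols that by auto
      then have vj: "v 1 k j = 0" using supp[of k j] that by (simp add: v_def q_def)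
      have *: "ip m x (col_fun (f k) j) = cnj (x j)" for x
      proof -
        have "ip m x (col_fun (f k) j) = ip m x (basis_vec j)"
          using cols that by (intro ip_cong) auto
        then show ?thesis using j by (simp add: ip_basis_right)
      qed
      have "col_fun (F 1 k) j i = col_fun (f k) j i"
        unfolding F1[OF k(1)] col_fun_apply_cols[OF fV(2)[OF k(2)] \<open>i < m\<close> j(2)]
        by (rule transport_orthogonal) (use uu k uj vj * in auto)
      then show ?thesis using cols that by simp
    qed
    show "col_fun (F 1 k) c i = p k i / of_real (nrm m (p k))" if "k \<in> half_cell S a" "i < m" for k i
    proof -
      have k: "k \<in> C" "k \<in> cube" using that C_cube by (auto simp: C_def)
      have "q 1 k = p k" by (auto simp: q_def)
      then show ?thesis
        unfolding F1[OF k(1)] col_fun_apply_cols[OF fV(2)[OF k(2)] \<open>i < m\<close> c]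
        using transport_source[OF uu[OF k(2)] vu[OF k(1), of 1], of i] by (simp add: u_def v_def)
    qed
  qed
qed

end

section \<open>General position\<close>

text \<open>Real coordinates of complex vectors, indexed by a complex coordinate and a flag selecting
  its imaginary part.\<close>

definition real_coord :: "(nat \<Rightarrow> complex) \<Rightarrow> nat \<times> bool \<Rightarrow> real" where
  "real_coord x r = (if snd r then Im (x (fst r)) else Re (x (fst r)))"

definition real_basis_vec :: "nat \<times> bool \<Rightarrow> nat \<Rightarrow> complex" where
  "real_basis_vec r i = (if i = fst r then if snd r then \<i> else 1 else 0)"

text \<open>Allows chosen real coordinates to be perturbed individually while all others stay
  unchanged.\<close>

lemma real_coord_shift:
  assumes "finite L"
  shows "real_coord (\<lambda>i. x i + (\<Sum>l\<in>L. of_real (a l) * real_basis_vec (h l) i)) r =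
     real_coord x r + (\<Sum>l\<in>L. if h l = r then a l else 0)"
  using assms
proof (induction L)
  case (insert l L)
  have "real_coord (\<lambda>i. y i + of_real b * real_basis_vec r' i) r = real_coord y r + (if r' = r then b else 0)" for y b r'
    by (cases r; cases r') (auto simp: real_coord_def real_basis_vec_def)
  from this[of "\<lambda>i. x i + (\<Sum>l\<in>L. of_real (a l) * real_basis_vec (h l) i)" "a l" "h l"] show ?case
    using insert by (simp add: algebra_simps)
qed (simp add: real_coord_def)

lemma Re_ip_real_basis_vec: "fst r < m \<Longrightarrow> Re (ip m x (real_basis_vec r)) = real_coord x r"
  by (cases r) (simp add: ip_def real_basis_vec_def real_coord_def if_distrib[of "\<lambda>z. _ * z"] cong: if_cong)

lemma ip_sum_right: "ip m x (\<lambda>i. \<Sum>l\<in>L. y l i) = (\<Sum>l\<in>L. ip m x (y l))"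
  unfolding ip_def sum_distrib_left by (rule sum.swap)

lemma unit_component_le:
  assumes "ip m x x = 1" "i < m"
  shows "cmod (x i) \<le> 1"
proof -
  have "(\<Sum>i<m. (cmod (x i))\<^sup>2) = 1"
    using assms(1) by (simp only: ip_self of_real_eq_1_iff)
  then have "(cmod (x i))\<^sup>2 \<le> 1"
    using member_le_sum[of i "{..<m}" "\<lambda>i. (cmod (x i))\<^sup>2"] assms(2) by simp
  then show ?thesis by (simp add: power_le_one_iff)
qed

lemma abs_real_coord_le:
  assumes "ip m x x = 1" "fst r < m"
  shows "\<bar>real_coord x r\<bar> \<le> 1"
  using unit_component_le[OF assms] abs_Re_le_cmod[of "x (fst r)"] abs_Im_le_cmod[of "x (fst r)"]
  by (auto simp: real_coord_def)

section \<open>Induction over columns and over cells\<close>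

context frame_involution
begin

text \<open>Column \<open>c\<close> is first perturbed to a \<open>p\<close> that is nowhere
  opposite to the basis vector \<open>c\<close>, then moved straight to that vector. Being opposite
  forces all real coordinates but one to vanish, and the dimension bound leaves enough of them for
  general position.\<close>

lemma fix_column:
  fixes f :: "real ^ 'd \<Rightarrow> complex mat"
  assumes dim: "CARD('d) \<le> 2 * (m - n)"
    and f: "f \<in> equivariant_maps TV g frame0"
    and fS: "\<And>k. k \<in> cell S \<Longrightarrow> f k = frame0" and a: "a \<notin> S" and c: "c < n"
    and cols: "\<And>k i j. k \<in> half_cell S a \<Longrightarrow> j < c \<Longrightarrow> i < m \<Longrightarrow> col_fun (f k) j i = basis_vec j i"
  obtains f' where "f \<simeq> f'" "\<And>k. k \<in> cell S \<Longrightarrow> f' k = frame0"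
    "\<And>k i j. k \<in> half_cell S a \<Longrightarrow> j < Suc c \<Longrightarrow> i < m \<Longrightarrow> col_fun (f' k) j i = basis_vec j i"
proof -
  define C where "C = half_cell S a"
  define u where "u k = col_fun (f k) c" for k
  have c_m: "c < m" using c n_le_m by simp
  have C_cube: "C \<subseteq> cube" by (simp add: C_def half_cell_subset)
  have fV: "f k \<in> V" if "k \<in> C" for k
    using f that C_cube by (auto simp: equivariant_maps_iff)
  have uu: "ip m (u k) (u k) = 1" if "k \<in> C" for k
    using fV[OF that] c by (simp add: u_def stiefel_iff)
  have u_cont: "continuous_on C (\<lambda>k. u k i)" if "i < m" for i
    unfolding u_def col_fun_def
    by (rule continuous_on_subset[OF _ C_cube]) (use f that c in \<open>simp add: equivariant_maps_iff\<close>)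

  \<comment> \<open>The real coordinates available to column \<open>c\<close>, without the real part
    of entry \<open>c\<close>, which points along the target vector.\<close>
  define R where "R = {c..<m} \<times> (UNIV :: bool set) - {(c, False)}"
  have "card R = 2 * (m - c) - 1"
    using c_m by (simp add: R_def card_cartesian_product)
  \<comment> \<open>Since \<open>c < n\<close>, there are at least \<open>2 * (m - n) + 1\<close>
    such coordinates, one more than the dimension of the cube. The type \<open>'d option\<close>
    indexes exactly that many.\<close>
  then have "CARD('d option) \<le> card R"
    using dim c n_le_m by simp
  then obtain h :: "'d option \<Rightarrow> nat \<times> bool" where h: "h ` UNIV \<subseteq> R" "inj h"
    using card_le_inj[of "UNIV :: 'd option set" R] by (auto simp: R_def)
  have hm: "c \<le> fst (h l)" "fst (h l) < m" "h l \<noteq> (c, False)" for l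
  proof -
    have "h l \<in> R" using h(1) by blast
    then show "c \<le> fst (h l)" "fst (h l) < m" "h l \<noteq> (c, False)" by (auto simp: R_def)
  qed

  define v :: "real ^ 'd \<Rightarrow> real ^ 'd option" where "v k = (\<chi> l. real_coord (u k) (h l))" for k
  have "continuous_on C (\<lambda>k. real_coord (u k) (h l))" for l
    unfolding real_coord_def by (cases "snd (h l)") (auto intro!: continuous_intros u_cont hm)
  then have v_cont: "continuous_on C v"
    unfolding v_def by (intro continuous_on_vec_lambda)
  \<comment> \<open>Chosen so that the perturbation, summed over all selected coordinates, changes
    the real part of \<open>ip m (u k) (p k)\<close> by at most 1/2.\<close>
  define \<epsilon> where "\<epsilon> = 1 / (2 * real CARD('d option))"
  obtain w where w: "continuous_on C w" "\<And>k. k \<in> C \<Longrightarrow> norm (w k - v k) < \<epsilon>" "\<And>k. k \<in> C \<Longrightarrow> w k \<noteq> 0"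
    using approximate_nonvanishing[OF _ v_cont, of \<epsilon>] by (auto simp: C_def compact_half_cell \<epsilon>_def)

  \<comment> \<open>This factor is 0 where the column equals the basis vector \<open>c\<close>, so
    boundary values survive, and 1 where the real part of entry \<open>c\<close> is nonpositive,
    which includes every place where the column could be opposite to it.\<close>
  define \<phi> where "\<phi> k = min 1 (1 - Re (u k c))" for k
  define p where "p k i = u k i + (\<Sum>l\<in>UNIV. of_real (\<phi> k * (w k $ l - v k $ l)) * real_basis_vec (h l) i)" for k i
  have \<phi>: "0 \<le> \<phi> k" "\<phi> k \<le> 1" if "k \<in> C" for k
    using unit_component_le[OF uu[OF that] c_m] complex_Re_le_cmod[of "u k c"] by (auto simp: \<phi>_def)
  have p_coord: "real_coord (p k) (h l) = v k $ l + \<phi> k * (w k $ l - v k $ l)" for k l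
    using h(2) unfolding p_def[abs_def] real_coord_shift[OF finite] by (simp add: inj_eq v_def)
  have p_c: "Re (p k c) = Re (u k c)" for k
  proof -
    have "real_coord (p k) (c, False) = real_coord (u k) (c, False)"
      using hm(3) unfolding p_def[abs_def] real_coord_shift[OF finite] by simp
    then show ?thesis by (simp add: real_coord_def)
  qed
  \<comment> \<open>A positive real product with \<open>u k\<close> excludes that \<open>p k\<close>
    is a nonpositive multiple of \<open>u k\<close>, the hypothesis \<open>not_neg\<close> of the
    first move.\<close>
  have p_pos: "0 < Re (ip m (u k) (p k))" if k: "k \<in> C" for k
  proof -
    have "\<bar>\<phi> k * (w k $ l - v k $ l) * v k $ l\<bar> \<le> \<epsilon>" for l
    proof -
      have "\<bar>w k $ l - v k $ l\<bar> \<le> \<epsilon>"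
        using component_le_norm_cart[of "w k - v k" l] w(2)[OF k] by simp
      moreover have "\<bar>v k $ l\<bar> \<le> 1" using abs_real_coord_le[OF uu[OF k] hm(2)] by (simp add: v_def)
      ultimately have "\<bar>\<phi> k\<bar> * \<bar>w k $ l - v k $ l\<bar> * \<bar>v k $ l\<bar> \<le> 1 * \<epsilon> * 1"
        using \<phi>[OF k] by (intro mult_mono) (auto simp: \<epsilon>_def)
      then show ?thesis by (simp add: abs_mult)
    qed
    then have "(\<Sum>l\<in>UNIV. \<bar>\<phi> k * (w k $ l - v k $ l) * v k $ l\<bar>) \<le> real CARD('d option) * \<epsilon>"
      by (rule sum_bounded_above)
    also have "\<dots> = 1 / 2" by (simp add: \<epsilon>_def)
    finally have "\<bar>\<Sum>l\<in>UNIV. \<phi> k * (w k $ l - v k $ l) * v k $ l\<bar> \<le> 1 / 2"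
      by (rule order_trans[OF sum_abs])
    moreover have "Re (ip m (u k) (p k)) = 1 + (\<Sum>l\<in>UNIV. \<phi> k * (w k $ l - v k $ l) * v k $ l)"
    proof -
      have "Re (of_real b * ip m (u k) (real_basis_vec (h l))) = b * v k $ l" for b l
        using Re_ip_real_basis_vec[OF hm(2)] by (simp add: v_def)
      moreover have "ip m (u k) (p k) = 1 + (\<Sum>l\<in>UNIV. of_real (\<phi> k * (w k $ l - v k $ l)) * ip m (u k) (real_basis_vec (h l)))"
        unfolding p_def[abs_def] ip_add_right ip_sum_right ip_scale_right uu[OF k] ..
      ultimately show ?thesis
        by (simp only: plus_complex.sel Re_sum one_complex.sel)
    qed
    ultimately show ?thesis by linarith
  qed
  have bd_frame: "f k = frame0" if "k \<in> C" "k \<in> frontier cube \<or> k $ a = 0" for k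
    using that f fS[of k] by (fastforce simp: equivariant_maps_iff C_def half_cell_def cell_def)

  obtain f1 where f1: "f \<simeq> f1" "\<And>k. k \<in> cell S \<Longrightarrow> f1 k = frame0"
    "\<And>k i j. k \<in> half_cell S a \<Longrightarrow> j < c \<Longrightarrow> i < m \<Longrightarrow> col_fun (f1 k) j i = basis_vec j i"
    "\<And>k i. k \<in> half_cell S a \<Longrightarrow> i < m \<Longrightarrow> col_fun (f1 k) c i = p k i / of_real (nrm m (p k))"
  proof (rule move_column[OF f fS a c cols, where p = p], unfold C_def[symmetric])
    show "continuous_on C (\<lambda>k. p k i)" if "i < m" for i
      unfolding p_def \<phi>_def
      by (intro continuous_intros continuous_on_component u_cont that c_m w(1) v_cont)
    show "p k i = 0" if "k \<in> C" "i < c" for k i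
    proof -
      have "col_fun (f k) c i = 0"
        using that c c_m fV cols by (intro stiefel_column_eq_0[of _ m n]) (auto simp: C_def)
      moreover have "real_basis_vec (h l) i = 0" for l
        using hm(1)[of l] that by (simp add: real_basis_vec_def)
      ultimately show ?thesis by (simp add: p_def u_def)
    qed
    show "\<exists>i<m. p k i \<noteq> - of_real r * col_fun (f k) c i" if k: "k \<in> C" and r: "0 \<le> r" for k r
    proof (rule ccontr)
      assume "\<not> ?thesis"
      then have "ip m (u k) (p k) = ip m (u k) (\<lambda>i. - of_real r * u k i)"
        by (intro ip_cong) (auto simp: u_def)
      then have "Re (ip m (u k) (p k)) = - r"
        by (simp only: ip_scale_right uu[OF k]) simp
      then show False using p_pos[OF k] r by simp
    qed
    show "p k i = basis_vec c i" if "k \<in> C" "k \<in> frontier cube \<or> k $ a = 0" "i < m" for k i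
    proof -
      have u: "u k j = basis_vec c j" if "j < m" for j
        using bd_frame[OF \<open>k \<in> C\<close>] \<open>k \<in> frontier cube \<or> k $ a = 0\<close> that c
        by (simp add: u_def col_fun_canonical_frame)
      then have "\<phi> k = 0" using c_m by (simp add: \<phi>_def basis_vec_def)
      then show ?thesis using u that by (simp add: p_def)
    qed
  qed auto
  obtain f2 where f2: "f1 \<simeq> f2" "\<And>k. k \<in> cell S \<Longrightarrow> f2 k = frame0"
    "\<And>k i j. k \<in> half_cell S a \<Longrightarrow> j < c \<Longrightarrow> i < m \<Longrightarrow> col_fun (f2 k) j i = basis_vec j i"
    "\<And>k i. k \<in> half_cell S a \<Longrightarrow> i < m \<Longrightarrow> col_fun (f2 k) c i = basis_vec c i / of_real (nrm m (basis_vec c))"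
  proof (rule move_column[OF equiv_homotopic_maps(2)[OF f1(1)] f1(2) a c f1(3), where p = "\<lambda>_. basis_vec c"],
      unfold C_def[symmetric])
    show "\<exists>i<m. basis_vec c i \<noteq> - of_real r * col_fun (f1 k) c i" if k: "k \<in> C" and r: "0 \<le> r" for k r
    proof (rule ccontr)
      assume *: "\<not> ?thesis"
      have "\<exists>i<m. p k i \<noteq> 0"
      proof (rule ccontr)
        assume "\<not> ?thesis"
        then have "ip m (u k) (p k) = 0" by (simp add: ip_def)
        then show False using p_pos[OF k] by simp
      qed
      then have N: "0 < nrm m (p k)" using nrm_pos by blast
      \<comment> \<open>If the perturbed column were opposite to the target, entry \<open>c\<close>
        of \<open>p k\<close> would have negative real part. That part is unperturbed, so
        \<open>\<phi> k = 1\<close> and the selected coordinates of \<open>p k\<close> are those of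
        \<open>w k\<close>; they would all vanish, contradicting the choice of
        \<open>w\<close>.\<close>
      have eq: "of_real (nrm m (p k)) * basis_vec c i = - of_real r * p k i" if "i < m" for i
        using * f1(4)[of k i] k that N by (auto simp: C_def field_simps)
      have "of_real (nrm m (p k)) = - of_real r * p k c" using eq[OF c_m] by (simp add: basis_vec_def)
      then have pc: "nrm m (p k) = - r * Re (p k c)" "0 = r * Im (p k c)"
        by (simp_all add: complex_eq_iff)
      then have r: "0 < r" and neg: "Re (u k c) < 0"
        using N r p_c[of k] by (auto simp: zero_less_mult_iff mult_less_0_iff)
      have "\<phi> k = 1" using neg by (simp add: \<phi>_def)
      have "w k $ l = 0" for l
      proof -
        have "real_coord (p k) (h l) = 0"
        proof (cases "fst (h l) = c")
          case True
          then show ?thesis using hm(3)[of l] pc(2) r by (cases "h l") (auto simp: real_coord_def)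
        next
          case False
          then show ?thesis using eq[OF hm(2)[of l]] r by (simp add: real_coord_def basis_vec_def)
        qed
        then show ?thesis by (simp add: p_coord \<open>\<phi> k = 1\<close>)
      qed
      then show False using w(3)[OF k] by (simp add: Finite_Cartesian_Product.vec_eq_iff)
    qed
  qed (auto simp: basis_vec_def)
  show ?thesis
  proof (rule that[of f2])
    show "f \<simeq> f2" using f1(1) f2(1) by (rule equiv_homotopic_trans)
    show "col_fun (f2 k) j i = basis_vec j i" if "k \<in> half_cell S a" "j < Suc c" "i < m" for k i j
      using f2(3,4)[OF that(1)] that nrm_unit[OF basis_vec_unit[OF c_m]] by (cases "j = c") auto
  qed (use f2 in auto)
qed

text \<open>Induction over the columns makes the map constant on the half cell; equivariance and the
  fixed base frame carry this to the mirror image.\<close>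

lemma fix_cell:
  fixes f :: "real ^ 'd \<Rightarrow> complex mat"
  assumes dim: "CARD('d) \<le> 2 * (m - n)"
    and f: "f \<in> equivariant_maps TV g frame0"
    and fS: "\<And>k. k \<in> cell S \<Longrightarrow> f k = frame0" and a: "a \<notin> S"
  obtains f' where "f \<simeq> f'" "\<And>k. k \<in> cell (insert a S) \<Longrightarrow> f' k = frame0"
proof -
  have *: "\<exists>f'. f \<simeq> f' \<and> (\<forall>k\<in>cell S. f' k = frame0) \<and>
      (\<forall>k\<in>half_cell S a. \<forall>j<c. \<forall>i<m. col_fun (f' k) j i = basis_vec j i)" if "c \<le> n" for c
    using that
  proof (induction c)
    case 0
    then show ?case using equiv_homotopic_refl[OF f] fS by auto
  next
    case (Suc c)
    then obtain f1 where f1: "f \<simeq> f1" "\<And>k. k \<in> cell S \<Longrightarrow> f1 k = frame0"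
      "\<And>k i j. k \<in> half_cell S a \<Longrightarrow> j < c \<Longrightarrow> i < m \<Longrightarrow> col_fun (f1 k) j i = basis_vec j i" by auto
    obtain f2 where "f1 \<simeq> f2" "\<And>k. k \<in> cell S \<Longrightarrow> f2 k = frame0"
      "\<And>k i j. k \<in> half_cell S a \<Longrightarrow> j < Suc c \<Longrightarrow> i < m \<Longrightarrow> col_fun (f2 k) j i = basis_vec j i"
      using fix_column[OF dim equiv_homotopic_maps(2)[OF f1(1)] f1(2) a _ f1(3), of c] Suc.prems by auto
    then show ?case using equiv_homotopic_trans[OF f1(1)] by blast
  qed
  from *[OF order_refl] obtain f' where f': "f \<simeq> f'"
    "\<forall>k\<in>half_cell S a. \<forall>j<n. \<forall>i<m. col_fun (f' k) j i = basis_vec j i"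
    by blast
  have maps: "f' k \<in> V" "f' (- k) = g (f' k)" if "k \<in> cube" for k
    using equiv_homotopic_maps(2)[OF f'(1)] that by (auto simp: equivariant_maps_iff)
  have half: "f' k = frame0" if "k \<in> half_cell S a" for k
    using that half_cell_subset(2) maps(1) f'(2) by (intro eq_canonical_frameI stiefel_carrier) auto
  have "f' k = frame0" if "k \<in> cell (insert a S)" for k
  proof (cases "0 \<le> k $ a")
    case True
    then show ?thesis using that half by (simp add: half_cell_def)
  next
    case False
    then have "- k \<in> half_cell S a"
      using that by (auto simp: half_cell_def cell_def uminus_cube)
    then have "f' (- (- k)) = g frame0"
      using half maps(2)[of "-k"] half_cell_subset(2) by auto
    then show ?thesis by (simp add: g_canonical)
  qed
  with f'(1) show ?thesis by (rule that)
qed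

text \<open>Induction over finite sets of coordinate directions. It starts from
  \<open>cell {}\<close>, which is the origin alone, and ends with the whole cube.\<close>

lemma null_homotopic:
  fixes f :: "real ^ 'd \<Rightarrow> complex mat"
  assumes dim: "CARD('d) \<le> 2 * (m - n)"
    and f: "f \<in> equivariant_maps TV g frame0" and f0: "f 0 = frame0"
  shows "f \<simeq> (\<lambda>_. frame0)"
proof -
  have "\<exists>f'. f \<simeq> f' \<and> (\<forall>k\<in>cell S. f' k = frame0)" for S :: "'d set"
    using finite[of S]
  proof (induction S)
    case empty
    then show ?case using equiv_homotopic_refl[OF f] f0 by (auto simp: cell_empty)
  next
    case (insert a S)
    then obtain f1 where f1: "f \<simeq> f1" "\<And>k. k \<in> cell S \<Longrightarrow> f1 k = frame0" by auto
    obtain f2 where "f1 \<simeq> f2" "\<And>k. k \<in> cell (insert a S) \<Longrightarrow> f2 k = frame0"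
      using fix_cell[OF dim equiv_homotopic_maps(2)[OF f1(1)] f1(2) insert.hyps(2)] by auto
    then show ?case using equiv_homotopic_trans[OF f1(1)] by blast
  qed
  from this[of UNIV] obtain f' where f': "f \<simeq> f'" "\<And>k. k \<in> cube \<Longrightarrow> f' k = frame0"
    by (auto simp: cell_UNIV)
  show ?thesis
    using equiv_homotopic_trans[OF f'(1) equiv_homotopic_const[OF equiv_homotopic_maps(2)[OF f'(1)] f'(2)]] .
qed

end

section \<open>The value at the origin\<close>

text \<open>For orthonormal \<open>p\<close> and \<open>q\<close> this is the complex linear
  rotation by \<open>\<theta>\<close> from \<open>p\<close> towards \<open>q\<close>, the identity
  on their orthogonal complement.\<close>

definition rot :: "nat \<Rightarrow> (nat \<Rightarrow> complex) \<Rightarrow> (nat \<Rightarrow> complex) \<Rightarrow> real \<Rightarrow> (nat \<Rightarrow> complex) \<Rightarrow> nat \<Rightarrow> complex" where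
  "rot m p q \<theta> x i = x i + (of_real (cos \<theta> - 1) * ip m p x - of_real (sin \<theta>) * ip m q x) * p i
     + (of_real (sin \<theta>) * ip m p x + of_real (cos \<theta> - 1) * ip m q x) * q i"

lemma ip_rot:
  assumes pp: "ip m p p = 1" and qq: "ip m q q = 1" and pq: "ip m p q = 0"
  shows "ip m (rot m p q \<theta> x) (rot m p q \<theta> y) = ip m x y"
proof -
  have qp: "ip m q p = 0" by (metis cnj_ip complex_cnj_zero pq)
  define c s where "c = complex_of_real (cos \<theta>)" and "s = complex_of_real (sin \<theta>)"
  have cs: "c * c + s * s = 1" "cnj c = c" "cnj s = s"
    using sin_cos_squared_add3[of \<theta>] by (simp_all add: c_def s_def flip: of_real_mult of_real_add)
  have rot: "rot m p q \<theta> z = (\<lambda>i. z i + ((c - 1) * ip m p z - s * ip m q z) * p i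
     + (s * ip m p z + (c - 1) * ip m q z) * q i)" for z
    by (auto simp: rot_def c_def s_def)
  have "ip m (rot m p q \<theta> x) (rot m p q \<theta> y) - ip m x y =
     (c * c + s * s - 1) * (ip m x p * ip m p y + ip m x q * ip m q y)"
    unfolding rot
    by (simp add: ip_add_left ip_add_right ip_scale_left ip_scale_right pp qq pq qp cs(2,3) cnj_ip)
       (simp add: algebra_simps)
  then show ?thesis by (simp add: cs(1))
qed

lemma rot_0: "rot m p q 0 x i = x i"
  by (simp add: rot_def)

lemma rot_cong: "(\<And>i. i < m \<Longrightarrow> x i = y i) \<Longrightarrow> i < m \<Longrightarrow> rot m p q \<theta> x i = rot m p q \<theta> y i"
  using ip_cong[of m p p x y] ip_cong[of m q q x y] by (simp add: rot_def)

lemma rot_scale: "rot m p q \<theta> (\<lambda>i. a * x i) i = a * rot m p q \<theta> x i"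
  by (simp add: rot_def ip_scale_right algebra_simps)

lemma rot_uminus_axes: "rot m (\<lambda>i. - p i) (\<lambda>i. - q i) \<theta> x = rot m p q \<theta> x"
  by (rule ext) (simp add: rot_def ip_minus_left algebra_simps)

lemma rot_orthogonal: "ip m p x = 0 \<Longrightarrow> ip m q x = 0 \<Longrightarrow> rot m p q \<theta> x = x"
  by (rule ext) (simp add: rot_def)

lemma rot_combination:
  assumes "ip m p p = 1" "ip m q q = 1" "ip m p q = 0"
    and x: "\<And>i. i < m \<Longrightarrow> x i = of_real a * p i + of_real b * q i" and i: "i < m"
  shows "rot m p q \<theta> x i = of_real (a * cos \<theta> - b * sin \<theta>) * p i + of_real (a * sin \<theta> + b * cos \<theta>) * q i"
proof -
  have qp: "ip m q p = 0" by (metis cnj_ip complex_cnj_zero assms(3))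
  have "ip m p x = ip m p (\<lambda>i. of_real a * p i + of_real b * q i)"
    "ip m q x = ip m q (\<lambda>i. of_real a * p i + of_real b * q i)"
    using x by (auto intro: ip_cong)
  then have "ip m p x = of_real a" "ip m q x = of_real b"
    using assms(1-3) qp by (simp_all add: ip_linear)
  then show ?thesis using x[OF i] by (simp add: rot_def algebra_simps)
qed

lemma continuous_on_rot:
  fixes X :: "'a::t2_space set"
  assumes "continuous_on X s" "\<And>i. i < m \<Longrightarrow> continuous_on X (\<lambda>z. x z i)" "i < m"
  shows "continuous_on X (\<lambda>z. rot m p q (s z) (x z) i)"
  unfolding rot_def by (intro continuous_intros assms)

text \<open>The coefficients \<open>cos \<theta>\<close> and \<open>sin \<theta>\<close> are real,
  so conjugation by an antiunitary map changes the axes but not the angle.\<close>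

lemma rot_antiunitary:
  assumes "\<And>x y. ip m (K x) (K y) = cnj (ip m x y)"
    and "\<And>x p q \<alpha> \<beta>. K (\<lambda>i. x i + \<alpha> * p i + \<beta> * q i) = (\<lambda>i. K x i + cnj \<alpha> * K p i + cnj \<beta> * K q i)"
  shows "K (rot m p q \<theta> x) = rot m (K p) (K q) \<theta> (K x)"
  unfolding rot_def[abs_def] assms by simp

text \<open>Rotations in mutually orthogonal planes: neither changes the coordinates read by the
  other.\<close>

lemma rot_commute:
  assumes "ip m p p' = 0" "ip m p q' = 0" "ip m q p' = 0" "ip m q q' = 0"
  shows "rot m p q \<theta> (rot m p' q' \<theta> x) = rot m p' q' \<theta> (rot m p q \<theta> x)"
proof -
  have "ip m p' p = 0" "ip m q' p = 0" "ip m p' q = 0" "ip m q' q = 0"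
    using assms by (metis cnj_ip complex_cnj_zero)+
  then have "ip m p (rot m p' q' \<theta> x) = ip m p x" "ip m q (rot m p' q' \<theta> x) = ip m q x"
    "ip m p' (rot m p q \<theta> x) = ip m p' x" "ip m q' (rot m p q \<theta> x) = ip m q' x"
    using assms by (simp_all add: rot_def[abs_def] ip_add_right ip_scale_right)
  then show ?thesis
    by (intro ext, simp add: rot_def[of m p q \<theta> "rot m p' q' \<theta> x"] rot_def[of m p' q' \<theta> "rot m p q \<theta> x"])
       (simp add: rot_def)
qed

text \<open>The fallback \<open>e\<close> yields a unit vector even for the zero vector; scaling
  back by the norm 0 still recovers \<open>x\<close> below \<open>m\<close>.\<close>

definition normalize_or :: "nat \<Rightarrow> (nat \<Rightarrow> complex) \<Rightarrow> (nat \<Rightarrow> complex) \<Rightarrow> nat \<Rightarrow> complex" where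
  "normalize_or m e x = (if nrm m x = 0 then e else (\<lambda>i. x i / of_real (nrm m x)))"

lemma normalize_or_unit: "ip m e e = 1 \<Longrightarrow> ip m (normalize_or m e x) (normalize_or m e x) = 1"
  by (simp add: normalize_or_def ip_normalized)

lemma normalize_or_scale:
  assumes "i < m"
  shows "of_real (nrm m x) * normalize_or m e x i = x i"
  using nrm_pos[OF assms, of x] by (cases "x i = 0") (auto simp: normalize_or_def)

text \<open>The parts of \<open>u\<close> on \<open>B\<close> and off \<open>B\<close> have squared
  norms adding up to 1, so their norms are a cosine and a sine. Indices \<open>c\<close> and
  \<open>d\<close> supply fallback directions for a part that vanishes; normalisation preserves real
  entries and, away from \<open>c\<close> and \<open>d\<close>, zero entries.\<close>

lemma split_unit_vector:
  assumes u: "ip m u u = 1" and c: "c \<in> B" "c < m" and d: "d \<notin> B" "d < m"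
  obtains p q \<phi> where "ip m p p = 1" "ip m q q = 1" "\<And>i. i \<notin> B \<Longrightarrow> p i = 0" "\<And>i. i \<in> B \<Longrightarrow> q i = 0"
    "\<And>i. i < m \<Longrightarrow> u i = of_real (cos \<phi>) * p i + of_real (sin \<phi>) * q i"
    "\<And>i. u i = 0 \<Longrightarrow> i \<noteq> c \<Longrightarrow> i \<noteq> d \<Longrightarrow> p i = 0 \<and> q i = 0"
    "\<And>i. cnj (u i) = u i \<Longrightarrow> cnj (p i) = p i \<and> cnj (q i) = q i"
proof -
  define x y where "x = (\<lambda>i. if i \<in> B then u i else 0)" and "y = (\<lambda>i. if i \<in> B then 0 else u i)"
  have u_eq: "u = (\<lambda>i. x i + y i)" by (auto simp: x_def y_def)
  have xy: "ip m x y = 0" "ip m y x = 0" by (auto simp: ip_def x_def y_def intro!: sum.neutral)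
  have "complex_of_real ((nrm m x)\<^sup>2 + (nrm m y)\<^sup>2) = ip m u u"
    unfolding of_real_add nrm_square by (simp add: u_eq ip_linear xy)
  then have "(nrm m x)\<^sup>2 + (nrm m y)\<^sup>2 = 1" using u by (simp only: of_real_eq_1_iff)
  then obtain \<phi> where \<phi>: "nrm m x = cos \<phi>" "nrm m y = sin \<phi>" using sincos_total_2pi by metis
  show ?thesis
  proof (rule that[of "normalize_or m (basis_vec c) x" "normalize_or m (basis_vec d) y" \<phi>])
    show "ip m (normalize_or m (basis_vec c) x) (normalize_or m (basis_vec c) x) = 1"
      "ip m (normalize_or m (basis_vec d) y) (normalize_or m (basis_vec d) y) = 1"
      using c d by (simp_all add: normalize_or_unit basis_vec_unit)
    show "u i = of_real (cos \<phi>) * normalize_or m (basis_vec c) x i + of_real (sin \<phi>) * normalize_or m (basis_vec d) y i"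
      if "i < m" for i
      using that by (simp add: normalize_or_scale u_eq flip: \<phi>)
  qed (use c d in \<open>auto simp: normalize_or_def x_def y_def basis_vec_def\<close>)
qed

section \<open>Deforming the value at the fixed point of the cube\<close>

context frame_involution
begin

text \<open>The whole map is acted on by \<open>R\<close>, with parameter damped by
  \<open>cell_cutoff {}\<close>. This factor is even, equals 1 at the origin and vanishes on the
  boundary; commutation with \<open>g\<close> gives equivariance.\<close>

lemma move_base_point:
  fixes f :: "real ^ 'd \<Rightarrow> complex mat" and R :: "real \<Rightarrow> (nat \<Rightarrow> complex) \<Rightarrow> nat \<Rightarrow> complex"
  assumes f: "f \<in> equivariant_maps TV g frame0"
    and R_ip: "\<And>t x y. ip m (R t x) (R t y) = ip m x y"
    and R_0: "\<And>x i. i < m \<Longrightarrow> R 0 x i = x i"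
    and R_cont: "\<And>(X :: (real \<times> (real ^ 'd)) set) s x i. continuous_on X s \<Longrightarrow>
      (\<And>i. i < m \<Longrightarrow> continuous_on X (\<lambda>z. x z i)) \<Longrightarrow> i < m \<Longrightarrow> continuous_on X (\<lambda>z. R (s z) (x z) i)"
    and R_g: "\<And>t A. A \<in> V \<Longrightarrow> g (apply_cols (R t) A) = apply_cols (R t) (g A)"
  shows "\<exists>f'. f \<simeq> f' \<and> f' 0 = apply_cols (R 1) (f 0)"
proof -
  define H where "H s k = apply_cols (R (s * cell_cutoff {} k)) (f k)" for s k
  have fV: "f k \<in> V" "f k \<in> carrier_mat m n" "f (- k) = g (f k)" if "k \<in> cube" for k
    using f that by (auto simp: equivariant_maps_iff stiefel_carrier)
  have f_cont: "continuous_on cube (\<lambda>k. f k $$ (i, j))" if "i < m" "j < n" for i j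
    using f that by (auto simp: equivariant_maps_iff)
  have id: "apply_cols (R 0) (f k) = f k" if "k \<in> cube" for k
    by (rule apply_cols_id[OF fV(2)[OF that]]) (rule R_0)
  have "f \<simeq> H 1"
  proof (rule equiv_homotopicI[where H = H])
    show "H t k \<in> V" if "k \<in> cube" for t k
      unfolding H_def using that by (intro apply_cols_stiefel fV R_ip)
    show "H t k = frame0" if "k \<in> frontier cube" for t k
    proof -
      have "cell_cutoff {} k = 0"
        using frontier_cube_cases[OF that, of "{}"] by (auto simp: cell_proj_def mem_frontier_cube_iff)
      then show ?thesis
        using that frontier_cube_subset id[of k] f by (auto simp: H_def equivariant_maps_iff)
    qed
    show "H t (- k) = g (H t k)" if "k \<in> cube" for t k
      using that by (simp add: H_def cell_cutoff_uminus R_g fV)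
    show "H 0 k = f k" if "k \<in> cube" for k
      using that id by (simp add: H_def)
    show "continuous_on ({0..1} \<times> cube) (\<lambda>z. H (fst z) (snd z) $$ (i, j))" if "i < m" "j < n" for i j
    proof -
      have "continuous_on ({0..1} \<times> cube) (\<lambda>z. R (fst z * cell_cutoff {} (snd z)) (col_fun (f (snd z)) j) i)"
        unfolding col_fun_def
        by (intro R_cont continuous_intros continuous_on_compose2[OF f_cont, of _ _ _ snd]
            continuous_on_compose2[OF continuous_on_cell_cutoff, of _ snd] that) auto
      moreover have "H (fst z) (snd z) $$ (i, j) = R (fst z * cell_cutoff {} (snd z)) (col_fun (f (snd z)) j) i"
        if "z \<in> {0..1} \<times> cube" for z
        unfolding H_def using that \<open>i < m\<close> \<open>j < n\<close> col_fun_apply_cols[OF fV(2)] by (auto simp: col_fun_def)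
      ultimately show ?thesis by (simp cong: continuous_on_cong)
    qed
  qed simp
  moreover have "H 1 0 = apply_cols (R 1) (f 0)"
    by (simp add: H_def cell_cutoff_def)
  ultimately show ?thesis by blast
qed

lemma equivariant_map_base_point:
  fixes f :: "real ^ 'd \<Rightarrow> complex mat"
  assumes "f \<in> equivariant_maps TV g frame0"
  shows "f 0 \<in> V" "g (f 0) = f 0"
proof -
  have "(0 :: real ^ 'd) \<in> cube" by (simp add: mem_cube_iff)
  then show "f 0 \<in> V" "g (f 0) = f 0"
    using assms by (auto simp: equivariant_maps_iff dest: bspec[of _ _ 0])
qed

text \<open>Two rotations: one turns the column onto \<open>q\<close>, a quarter turn then takes
  \<open>q\<close> to the basis vector \<open>c\<close>. The detour is used because \<open>p\<close>
  may be, for example, the negative of that vector, whereas \<open>q\<close> is orthogonal to it.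
  \<open>adm\<close> and \<open>R\<close> stand for the axes and rotations compatible with the
  action.\<close>

lemma fix_base_column:
  fixes f :: "real ^ 'd \<Rightarrow> complex mat"
  assumes move: "\<And>f p q \<theta>. (f :: real ^ 'd \<Rightarrow> complex mat) \<in> equivariant_maps TV g frame0 \<Longrightarrow> adm p q \<Longrightarrow>
      \<exists>f'. f \<simeq> f' \<and> f' 0 = apply_cols (R p q \<theta>) (f 0)"
    and combination: "\<And>p q \<theta> a b x i. adm p q \<Longrightarrow> (\<And>i. i < m \<Longrightarrow> x i = of_real a * p i + of_real b * q i) \<Longrightarrow> i < m \<Longrightarrow>
      R p q \<theta> x i = of_real (a * cos \<theta> - b * sin \<theta>) * p i + of_real (a * sin \<theta> + b * cos \<theta>) * q i"
    and orthogonal: "\<And>p q \<theta> x j i. adm p q \<Longrightarrow> (\<And>i. i < c \<Longrightarrow> p i = 0 \<and> q i = 0) \<Longrightarrow> j < c \<Longrightarrow>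
      (\<And>i. i < m \<Longrightarrow> x i = basis_vec j i) \<Longrightarrow> i < m \<Longrightarrow> R p q \<theta> x i = basis_vec j i"
    and c: "c < n" and f: "f \<in> equivariant_maps TV g frame0"
    and cols: "\<And>i j. j < c \<Longrightarrow> i < m \<Longrightarrow> col_fun (f 0) j i = basis_vec j i"
    and adm: "adm p q" "adm q (basis_vec c)" and supp: "\<And>i. i < c \<Longrightarrow> p i = 0 \<and> q i = 0"
    and col: "\<And>i. i < m \<Longrightarrow> col_fun (f 0) c i = of_real (cos \<phi>) * p i + of_real (sin \<phi>) * q i"
  shows "\<exists>f'. f \<simeq> f' \<and> (\<forall>j<Suc c. \<forall>i<m. col_fun (f' 0) j i = basis_vec j i)"
proof -
  \<comment> \<open>The column sits at angle \<open>\<phi>\<close> from \<open>p\<close>; turning by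
    the complement of \<open>\<phi>\<close> brings it to \<open>q\<close>.\<close>
  obtain f1 where f1: "f \<simeq> f1" "f1 0 = apply_cols (R p q (pi/2 - \<phi>)) (f 0)"
    using move[OF f adm(1)] by blast
  obtain f2 where f2: "f1 \<simeq> f2" "f2 0 = apply_cols (R q (basis_vec c) (pi/2)) (f1 0)"
    using move[OF equiv_homotopic_maps(2)[OF f1(1)] adm(2)] by blast
  have carrier: "f 0 \<in> carrier_mat m n" "f1 0 \<in> carrier_mat m n"
    using equivariant_map_base_point(1)[OF f] equivariant_map_base_point(1)[OF equiv_homotopic_maps(2)[OF f1(1)]]
    by (auto simp: stiefel_carrier)
  have col1: "col_fun (f1 0) c i = q i" if "i < m" for i
  proof -
    have "R p q (pi/2 - \<phi>) (col_fun (f 0) c) i = of_real (cos \<phi> * cos (pi/2 - \<phi>) - sin \<phi> * sin (pi/2 - \<phi>)) * p i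
        + of_real (cos \<phi> * sin (pi/2 - \<phi>) + sin \<phi> * cos (pi/2 - \<phi>)) * q i"
      by (rule combination[OF adm(1) col that])
    also have "\<dots> = q i" by (simp add: sin_diff cos_diff flip: of_real_mult of_real_add)
    finally show ?thesis using col_fun_apply_cols[OF carrier(1) that c] f1(2) by simp
  qed
  have "col_fun (f2 0) c i = basis_vec c i" if "i < m" for i
  proof -
    have "R q (basis_vec c) (pi/2) (col_fun (f1 0) c) i = of_real (1 * cos (pi/2) - 0 * sin (pi/2)) * q i
        + of_real (1 * sin (pi/2) + 0 * cos (pi/2)) * basis_vec c i"
      by (rule combination[OF adm(2) _ that]) (simp add: col1)
    then show ?thesis using col_fun_apply_cols[OF carrier(2) that c] f2(2) by simp
  qed
  moreover have "col_fun (f2 0) j i = basis_vec j i" if "j < c" "i < m" for i j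
  proof -
    have j: "j < n" using that c by simp
    have "col_fun (f1 0) j i = basis_vec j i" if "i < m" for i
      using orthogonal[OF adm(1) supp \<open>j < c\<close> cols[OF \<open>j < c\<close>] that] col_fun_apply_cols[OF carrier(1) that j] f1(2)
      by simp
    then show ?thesis
      using orthogonal[OF adm(2) _ \<open>j < c\<close> _ that(2)] supp col_fun_apply_cols[OF carrier(2) that(2) j] f2(2)
      by (simp add: basis_vec_def)
  qed
  ultimately have "\<forall>j<Suc c. \<forall>i<m. col_fun (f2 0) j i = basis_vec j i"
    by (simp add: less_Suc_eq)
  then show ?thesis using equiv_homotopic_trans[OF f1(1) f2(1)] by blast
qed

lemma fix_base_point:
  fixes f :: "real ^ 'd \<Rightarrow> complex mat"
  assumes step: "\<And>f c. (f :: real ^ 'd \<Rightarrow> complex mat) \<in> equivariant_maps TV g frame0 \<Longrightarrow> c < n \<Longrightarrow>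
      (\<And>i j. j < c \<Longrightarrow> i < m \<Longrightarrow> col_fun (f 0) j i = basis_vec j i) \<Longrightarrow>
      \<exists>f'. f \<simeq> f' \<and> (\<forall>j<Suc c. \<forall>i<m. col_fun (f' 0) j i = basis_vec j i)"
    and f: "f \<in> equivariant_maps TV g frame0"
  shows "\<exists>f'. f \<simeq> f' \<and> f' 0 = frame0"
proof -
  have *: "\<exists>f'. f \<simeq> f' \<and> (\<forall>j<c. \<forall>i<m. col_fun (f' 0) j i = basis_vec j i)" if "c \<le> n" for c
    using that
  proof (induction c)
    case 0
    then show ?case using equiv_homotopic_refl[OF f] by auto
  next
    case (Suc c)
    then obtain f1 where f1: "f \<simeq> f1" "\<And>i j. j < c \<Longrightarrow> i < m \<Longrightarrow> col_fun (f1 0) j i = basis_vec j i" by auto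
    obtain f2 where "f1 \<simeq> f2" "\<forall>j<Suc c. \<forall>i<m. col_fun (f2 0) j i = basis_vec j i"
      using step[OF equiv_homotopic_maps(2)[OF f1(1)] _ f1(2), of c] Suc.prems by auto
    then show ?case using equiv_homotopic_trans[OF f1(1)] by blast
  qed
  from *[OF order_refl] obtain f' where f': "f \<simeq> f'" "\<forall>j<n. \<forall>i<m. col_fun (f' 0) j i = basis_vec j i"
    by blast
  moreover have "f' 0 = frame0"
    using equivariant_map_base_point(1)[OF equiv_homotopic_maps(2)[OF f'(1)]] f'(2)
    by (intro eq_canonical_frameI stiefel_carrier) auto
  ultimately show ?thesis by blast
qed

lemma card_equivariant_homotopy_classes:
  assumes dim: "CARD('d) \<le> 2 * (m - n)"
    and base: "\<And>f. (f :: real ^ 'd \<Rightarrow> complex mat) \<in> equivariant_maps TV g frame0 \<Longrightarrow> \<exists>f'. f \<simeq> f' \<and> f' 0 = frame0"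
  shows "card (equivariant_homotopy_classes TV g frame0 :: (real ^ 'd \<Rightarrow> complex mat) set set) = 1"
proof -
  define r where "r = (equivariant_homotopy_rel TV g frame0 :: ((real ^ 'd \<Rightarrow> complex mat) \<times> (real ^ 'd \<Rightarrow> complex mat)) set)"
  define k where "k = ((\<lambda>_. frame0) :: real ^ 'd \<Rightarrow> complex mat)"
  have r: "(f, f') \<in> r \<longleftrightarrow> f \<simeq> f'" for f f'
    by (simp add: r_def equivariant_homotopy_rel_def equiv_homotopic_def)
  have "f \<simeq> k" if f: "f \<in> equivariant_maps TV g frame0" for f
  proof -
    obtain f' where f': "f \<simeq> f'" "f' 0 = frame0" using base[OF f] by blast
    show ?thesis
      using equiv_homotopic_trans[OF f'(1) null_homotopic[OF dim equiv_homotopic_maps(2)[OF f'(1)] f'(2)]]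
      by (simp add: k_def)
  qed
  then have "r `` {f} = r `` {k}" if "f \<in> equivariant_maps TV g frame0" for f
    using that r equiv_homotopic_trans equiv_homotopic_sym by blast
  moreover have "k \<in> equivariant_maps TV g frame0"
    using n_le_m by (auto simp: equivariant_maps_iff k_def g_canonical canonical_frame_stiefel)
  ultimately have "equivariant_maps TV g frame0 // r = {r `` {k}}"
    unfolding quotient_def by blast
  then show ?thesis
    by (simp add: equivariant_homotopy_classes_def r_def)
qed

end

section \<open>The two actions\<close>

definition conj_vec :: "(nat \<Rightarrow> complex) \<Rightarrow> nat \<Rightarrow> complex" where
  "conj_vec x = (\<lambda>i. cnj (x i))"

lemma ip_conj_vec: "ip m (conj_vec x) (conj_vec y) = cnj (ip m x y)"
  by (simp add: ip_def conj_vec_def)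

lemma conj_vec_rot: "conj_vec (rot m p q \<theta> x) = rot m (conj_vec p) (conj_vec q) \<theta> (conj_vec x)"
  by (rule rot_antiunitary) (auto simp: ip_conj_vec, simp add: conj_vec_def)

definition partner :: "nat \<Rightarrow> nat" where
  "partner i = (if even i then i + 1 else i - 1)"

text \<open>The map \<open>x \<mapsto> - \<i> (I \<otimes> \<sigma>\<^sub>2) cnj x\<close>, a quaternionic structure on vectors of even length.\<close>

definition quat_vec :: "(nat \<Rightarrow> complex) \<Rightarrow> nat \<Rightarrow> complex" where
  "quat_vec x = (\<lambda>i. if even i then - cnj (x (partner i)) else cnj (x (partner i)))"

lemma partner_less: "even m \<Longrightarrow> i < m \<Longrightarrow> partner i < m"
  by (auto simp: partner_def elim!: evenE)

lemma partner_partner [simp]: "partner (partner i) = i"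
  by (auto simp: partner_def)

lemma even_partner [simp]: "even (partner i) \<longleftrightarrow> odd i"
  by (auto simp: partner_def)

lemma partner_inject [simp]: "partner i = partner j \<longleftrightarrow> i = j"
  by (metis partner_partner)

lemma quat_vec_quat_vec: "quat_vec (quat_vec x) = (\<lambda>i. - x i)"
  by (auto simp: quat_vec_def)

lemma ip_quat_vec:
  assumes "even m"
  shows "ip m (quat_vec x) (quat_vec y) = cnj (ip m x y)"
proof -
  have "ip (2 * k) (quat_vec x) (quat_vec y) = cnj (ip (2 * k) x y)" for k
    by (induction k) (simp_all add: ip_def quat_vec_def partner_def)
  with assms show ?thesis by (auto elim: evenE)
qed

text \<open>The two terms from each adjacent pair of coordinates cancel, so the induction runs over
  pairs.\<close>

lemma ip_quat_vec_self:
  assumes "even m"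
  shows "ip m x (quat_vec x) = 0"
proof -
  have "ip (2 * k) x (quat_vec x) = 0" for k
    by (induction k) (simp_all add: ip_def quat_vec_def partner_def)
  with assms show ?thesis by (auto elim: evenE)
qed

lemma quat_vec_cong:
  "even m \<Longrightarrow> (\<And>i. i < m \<Longrightarrow> x i = y i) \<Longrightarrow> i < m \<Longrightarrow> quat_vec x i = quat_vec y i"
  by (simp add: quat_vec_def partner_less)

lemma quat_vec_basis_vec: "even c \<Longrightarrow> quat_vec (basis_vec c) = basis_vec (Suc c)"
  by (auto simp: quat_vec_def basis_vec_def partner_def fun_eq_iff)

lemma quat_vec_rot:
  assumes "even m"
  shows "quat_vec (rot m p q \<theta> x) = rot m (quat_vec p) (quat_vec q) \<theta> (quat_vec x)"
  by (rule rot_antiunitary) (simp add: ip_quat_vec[OF assms], auto simp: quat_vec_def fun_eq_iff)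

definition quat_rot :: "nat \<Rightarrow> (nat \<Rightarrow> complex) \<Rightarrow> (nat \<Rightarrow> complex) \<Rightarrow> real \<Rightarrow> (nat \<Rightarrow> complex) \<Rightarrow> nat \<Rightarrow> complex" where
  "quat_rot m p q \<theta> x = rot m p q \<theta> (rot m (quat_vec p) (quat_vec q) \<theta> x)"

text \<open>These conditions suffice for \<open>p\<close>, \<open>q\<close> and their images under
  \<open>quat_vec\<close> to be four orthonormal vectors; the other relations follow from
  antiunitarity and from \<open>ip_quat_vec_self\<close>.\<close>

definition quat_orthonormal :: "nat \<Rightarrow> (nat \<Rightarrow> complex) \<Rightarrow> (nat \<Rightarrow> complex) \<Rightarrow> bool" where
  "quat_orthonormal m p q \<longleftrightarrow> ip m p p = 1 \<and> ip m q q = 1 \<and> ip m p q = 0 \<and> ip m p (quat_vec q) = 0"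

lemma quat_orthonormal_ips:
  assumes "even m" "quat_orthonormal m p q"
  shows "ip m p p = 1" "ip m q q = 1" "ip m p q = 0" "ip m (quat_vec p) (quat_vec p) = 1"
    "ip m (quat_vec q) (quat_vec q) = 1" "ip m (quat_vec p) (quat_vec q) = 0"
    "ip m p (quat_vec p) = 0" "ip m p (quat_vec q) = 0" "ip m q (quat_vec p) = 0" "ip m q (quat_vec q) = 0"
proof -
  show *: "ip m p p = 1" "ip m q q = 1" "ip m p q = 0" "ip m p (quat_vec q) = 0"
    using assms(2) by (auto simp: quat_orthonormal_def)
  show "ip m (quat_vec p) (quat_vec p) = 1" "ip m (quat_vec q) (quat_vec q) = 1" "ip m (quat_vec p) (quat_vec q) = 0"
    using * by (simp_all add: ip_quat_vec assms(1))
  show "ip m p (quat_vec p) = 0" "ip m q (quat_vec q) = 0"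
    by (simp_all add: ip_quat_vec_self assms(1))
  have "ip m (quat_vec p) (quat_vec (quat_vec q)) = 0"
    using *(4) by (simp add: ip_quat_vec assms(1))
  then have "ip m (quat_vec p) q = 0" by (simp add: quat_vec_quat_vec ip_minus_right)
  then show "ip m q (quat_vec p) = 0" by (metis cnj_ip complex_cnj_zero)
qed

lemma ip_quat_rot:
  assumes "even m" "quat_orthonormal m p q"
  shows "ip m (quat_rot m p q \<theta> x) (quat_rot m p q \<theta> y) = ip m x y"
  using quat_orthonormal_ips[OF assms] by (simp add: quat_rot_def ip_rot)

text \<open>The quaternionic structure exchanges the two rotations. Its square is -1, but negating
  both axes leaves a rotation unchanged, and the two rotations commute because their planes are
  orthogonal.\<close>

lemma quat_vec_quat_rot:
  assumes "even m" "quat_orthonormal m p q"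
  shows "quat_vec (quat_rot m p q \<theta> x) = quat_rot m p q \<theta> (quat_vec x)"
proof -
  have "quat_vec (quat_rot m p q \<theta> x) = rot m (quat_vec p) (quat_vec q) \<theta> (rot m p q \<theta> (quat_vec x))"
    by (simp add: quat_rot_def quat_vec_rot assms(1) quat_vec_quat_vec rot_uminus_axes)
  also have "\<dots> = quat_rot m p q \<theta> (quat_vec x)"
    unfolding quat_rot_def by (rule rot_commute[symmetric]) (use quat_orthonormal_ips[OF assms] in auto)
  finally show ?thesis .
qed

lemma quat_rot_cong:
  "(\<And>i. i < m \<Longrightarrow> x i = y i) \<Longrightarrow> i < m \<Longrightarrow> quat_rot m p q \<theta> x i = quat_rot m p q \<theta> y i"
  unfolding quat_rot_def by (intro rot_cong) auto

lemma continuous_on_quat_rot: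
  fixes X :: "'a::t2_space set"
  assumes "continuous_on X s" "\<And>i. i < m \<Longrightarrow> continuous_on X (\<lambda>z. x z i)" "i < m"
  shows "continuous_on X (\<lambda>z. quat_rot m p q (s z) (x z) i)"
  unfolding quat_rot_def by (intro continuous_on_rot assms)

lemma quat_rot_0: "quat_rot m p q 0 x i = x i"
  by (simp add: quat_rot_def rot_0)

lemma quat_rot_scale: "quat_rot m p q \<theta> (\<lambda>i. a * x i) i = a * quat_rot m p q \<theta> x i"
  by (simp add: quat_rot_def rot_scale[abs_def])

section \<open>Both actions are continuous involutions fixing the canonical frame\<close>

lemma frame_involution_bdi: "n \<le> m \<Longrightarrow> frame_involution m n bdi_action"
proof
  assume nm: "n \<le> m"
  show "n \<le> m" by fact
  have entry: "bdi_action A $$ (i, j) = cnj (A $$ (i, j))" if "A \<in> carrier_mat m n" "i < m" "j < n" for A i j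
    using that by (simp add: bdi_action_def)
  have V: "bdi_action A \<in> stiefel m n" if A: "A \<in> stiefel m n" for A
  proof -
    have "ip m (col_fun (bdi_action A) j) (col_fun (bdi_action A) l) = cnj (ip m (col_fun A j) (col_fun A l))"
      if "j < n" "l < n" for j l
      unfolding ip_conj_vec[symmetric]
      by (rule ip_cong) (use that stiefel_carrier[OF A] in \<open>auto simp: col_fun_def entry conj_vec_def\<close>)
    then show ?thesis using A by (auto simp: stiefel_iff bdi_action_def)
  qed
  have id: "continuous_map (stiefel_topology m n) euclidean (\<lambda>A. A $$ (i, j))" if "i < m" "j < n" for i j
    using continuous_map_id[of "stiefel_topology m n"] that unfolding continuous_map_stiefel_topology by auto
  have "continuous_map (stiefel_topology m n) euclidean (\<lambda>A. bdi_action A $$ (i, j))" if "i < m" "j < n" for i j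
  proof -
    have "continuous_map euclidean euclidean cnj"
      by (intro continuous_map_iff_continuous2[THEN iffD2] continuous_intros)
    from continuous_map_compose[OF id[OF that] this] show ?thesis
      by (rule continuous_map_eq) (use that in \<open>auto simp: topspace_stiefel_topology entry stiefel_carrier\<close>)
  qed
  then show "continuous_map (stiefel_topology m n) (stiefel_topology m n) bdi_action"
    by (simp add: continuous_map_stiefel_topology topspace_stiefel_topology V)
  show "bdi_action (bdi_action A) = A" if "A \<in> stiefel m n" for A
    by (rule eq_matI) (auto simp: bdi_action_def)
  show "bdi_action (canonical_frame m n) = canonical_frame m n"
    by (rule eq_matI) (auto simp: bdi_action_def canonical_frame_def)
qed

lemma cii_carrier: "even m \<Longrightarrow> even n \<Longrightarrow> A \<in> carrier_mat m n \<Longrightarrow> cii_action m n A \<in> carrier_mat m n"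
  by (auto simp: cii_action_def kronecker_mat_def sigma2_def mat_of_rows_list_def elim!: evenE)

lemma kronecker_sigma2:
  assumes "even m" "i < m" "j < m"
  shows "((1\<^sub>m (m div 2)) \<otimes>\<^sub>K sigma2) $$ (i, j) = (if j = partner i then if even i then - \<i> else \<i> else 0)"
proof -
  have div: "i div 2 < m div 2" "j div 2 < m div 2" "m div 2 * 2 = m" using assms by (auto elim!: evenE)
  have \<sigma>: "sigma2 $$ (0, 0) = 0" "sigma2 $$ (0, Suc 0) = - \<i>" "sigma2 $$ (Suc 0, 0) = \<i>" "sigma2 $$ (Suc 0, Suc 0) = 0"
    by (simp_all add: sigma2_def mat_of_rows_list_def)
  have "dim_row sigma2 = 2" "dim_col sigma2 = 2"
    by (simp_all add: sigma2_def mat_of_rows_list_def)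
  then have eq: "((1\<^sub>m (m div 2)) \<otimes>\<^sub>K sigma2) $$ (i, j) = (if i div 2 = j div 2 then sigma2 $$ (i mod 2, j mod 2) else 0)"
    using assms div by (simp add: kronecker_mat_def)
  have p: "j = partner i \<longleftrightarrow> i div 2 = j div 2 \<and> (even i \<longleftrightarrow> odd j)"
    by (cases "even i"; cases "even j") (auto simp: partner_def elim!: evenE oddE, presburger+)
  show ?thesis
    unfolding eq p by (cases "even i"; cases "even j") (simp_all add: \<sigma> even_iff_mod_2_eq_zero odd_iff_mod_2_eq_one)
qed

lemma cii_entry:
  assumes "even m" "even n" "A \<in> carrier_mat m n" "i < m" "j < n"
  shows "cii_action m n A $$ (i, j) = (if even i = even j then 1 else -1) * cnj (A $$ (partner i, partner j))"
proof -
  let ?S = "\<lambda>k. (1\<^sub>m (k div 2)) \<otimes>\<^sub>K sigma2"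
  have S: "?S k \<in> carrier_mat k k" if "even k" for k
    using that by (auto simp: kronecker_mat_def sigma2_def mat_of_rows_list_def elim!: evenE)
  define X where "X = ?S m * map_mat cnj A"
  have X: "X \<in> carrier_mat m n" using S[OF assms(1)] assms by (simp add: X_def)
  have SA: "X $$ (i, l) = (if even i then - \<i> else \<i>) * cnj (A $$ (partner i, l))" if "l < n" for l
  proof -
    have "X $$ (i, l) = (\<Sum>k<m. ?S m $$ (i, k) * cnj (A $$ (k, l)))"
      using S[OF assms(1)] assms that by (auto simp: X_def scalar_prod_def atLeast0LessThan)
    also have "\<dots> = (\<Sum>k<m. if k = partner i then (if even i then - \<i> else \<i>) * cnj (A $$ (k, l)) else 0)"
      using assms by (intro sum.cong) (auto simp: kronecker_sigma2)
    finally show ?thesis using partner_less[OF assms(1,4)] by simp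
  qed
  have "cii_action m n A $$ (i, j) = (\<Sum>l<n. X $$ (i, l) * ?S n $$ (l, j))"
    unfolding cii_action_def X_def[symmetric] using X S[OF assms(2)] assms
    by (auto simp: scalar_prod_def atLeast0LessThan)
  also have "\<dots> = (\<Sum>l<n. if l = partner j then X $$ (i, l) * (if even l then - \<i> else \<i>) else 0)"
    using assms by (intro sum.cong) (auto simp: kronecker_sigma2)
  \<comment> \<open>The sign is now governed by the parity of \<open>j\<close>, opposite to that of
    \<open>partner j\<close>.\<close>
  also have "\<dots> = X $$ (i, partner j) * (if even j then \<i> else - \<i>)"
    using partner_less[OF assms(2,5)] by simp
  finally show ?thesis using SA[OF partner_less[OF assms(2,5)]] by auto
qed

text \<open>In a frame fixed by the action, each column of odd index is therefore
  \<open>quat_vec\<close> of the preceding column, so only columns of even index need to be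
  moved.\<close>

lemma col_fun_cii:
  assumes "even m" "even n" "A \<in> carrier_mat m n" "i < m" "j < n"
  shows "col_fun (cii_action m n A) j i = (if even j then -1 else 1) * quat_vec (col_fun A (partner j)) i"
  using assms by (auto simp: col_fun_def cii_entry quat_vec_def)

lemma frame_involution_cii:
  assumes nm: "n \<le> m" and ev: "even m" "even n"
  shows "frame_involution m n (cii_action m n)"
proof
  show "n \<le> m" by fact
  have V: "cii_action m n A \<in> stiefel m n" if A: "A \<in> stiefel m n" for A
  proof -
    have A': "A \<in> carrier_mat m n" using A by (rule stiefel_carrier)
    have "ip m (col_fun (cii_action m n A) j) (col_fun (cii_action m n A) l) = (if j = l then 1 else 0)"
      if "j < n" "l < n" for j l
    proof -
      let ?s = "\<lambda>j. if even j then -1 else 1 :: complex"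
      have "ip m (col_fun (cii_action m n A) j) (col_fun (cii_action m n A) l)
          = ip m (\<lambda>i. ?s j * quat_vec (col_fun A (partner j)) i) (\<lambda>i. ?s l * quat_vec (col_fun A (partner l)) i)"
        using that by (intro ip_cong col_fun_cii ev A')
      also have "\<dots> = cnj (?s j) * ?s l * cnj (ip m (col_fun A (partner j)) (col_fun A (partner l)))"
        by (simp only: ip_scale_left ip_scale_right ip_quat_vec[OF ev(1)] mult.assoc)
      also have "\<dots> = (if j = l then 1 else 0)"
        using A that partner_less[OF ev(2)] by (auto simp: stiefel_iff)
      finally show ?thesis .
    qed
    then show ?thesis using cii_carrier[OF ev A'] by (simp add: stiefel_iff)
  qed
  have id: "continuous_map (stiefel_topology m n) euclidean (\<lambda>A. A $$ (i, j))" if "i < m" "j < n" for i j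
    using continuous_map_id[of "stiefel_topology m n"] that unfolding continuous_map_stiefel_topology by auto
  have "continuous_map (stiefel_topology m n) euclidean (\<lambda>A. cii_action m n A $$ (i, j))" if "i < m" "j < n" for i j
  proof -
    have "continuous_map euclidean euclidean (\<lambda>z. (if even i = even j then 1 else -1) * cnj z)"
      by (intro continuous_map_iff_continuous2[THEN iffD2] continuous_intros)
    from continuous_map_compose[OF id[OF partner_less partner_less, OF ev(1) that(1) ev(2) that(2)] this]
    show ?thesis
      by (rule continuous_map_eq) (use that ev in \<open>simp add: topspace_stiefel_topology cii_entry stiefel_carrier\<close>)
  qed
  then show "continuous_map (stiefel_topology m n) (stiefel_topology m n) (cii_action m n)"
    by (simp add: continuous_map_stiefel_topology topspace_stiefel_topology V)
  show "cii_action m n (cii_action m n A) = A" if A: "A \<in> stiefel m n" for A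
    by (rule eq_matI)
      (use stiefel_carrier[OF A] stiefel_carrier[OF V[OF V[OF A]]] stiefel_carrier[OF V[OF A]] ev in
        \<open>auto simp: cii_entry partner_less\<close>)
  show "cii_action m n (canonical_frame m n) = canonical_frame m n"
    by (rule eq_matI)
      (use canonical_frame_carrier[of m n] cii_carrier[OF ev canonical_frame_carrier] ev in
        \<open>auto simp: cii_entry partner_less canonical_frame_def\<close>)
qed

section \<open>Triviality of the homotopy classes in the two symmetry classes\<close>

lemma card_classes_bdi:
  assumes "n < m" and dim: "CARD('d) \<le> 2 * (m - n)"
  shows "card (equivariant_homotopy_classes (stiefel_topology m n) bdi_action (canonical_frame m n)
     :: (real ^ 'd \<Rightarrow> complex mat) set set) = 1"
proof -
  interpret frame_involution m n bdi_action
    using assms by (intro frame_involution_bdi) simp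
  define adm where "adm p q \<longleftrightarrow> ip m p p = 1 \<and> ip m q q = 1 \<and> ip m p q = 0 \<and> conj_vec p = p \<and> conj_vec q = q" for p q
  show ?thesis
  proof (intro card_equivariant_homotopy_classes dim fix_base_point)
    fix f :: "real ^ 'd \<Rightarrow> complex mat" and c
    assume f: "f \<in> equivariant_maps TV bdi_action frame0" and c: "c < n"
      and cols: "\<And>i j. j < c \<Longrightarrow> i < m \<Longrightarrow> col_fun (f 0) j i = basis_vec j i"
    note V = equivariant_map_base_point[OF f]
    \<comment> \<open>Cutting off beyond row \<open>m\<close> makes every entry real, not only the
      meaningful ones.\<close>
    define u where "u i = (if i < m then col_fun (f 0) c i else 0)" for i
    have "ip m u u = ip m (col_fun (f 0) c) (col_fun (f 0) c)"
      by (intro ip_cong) (auto simp: u_def)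
    then have uu: "ip m u u = 1" using V(1) c by (simp add: stiefel_iff)
    have "c < m" "Suc c < m" using c assms(1) by auto
    \<comment> \<open>With \<open>B = {c}\<close> the vector \<open>p\<close> is plus or minus the
      basis vector \<open>c\<close>, and \<open>q\<close> is orthogonal to it. The spare row
      \<open>Suc c\<close> exists because \<open>n < m\<close>.\<close>
    obtain p q \<phi> where pq: "ip m p p = 1" "ip m q q = 1" "\<And>i. i \<notin> {c} \<Longrightarrow> p i = 0" "\<And>i. i \<in> {c} \<Longrightarrow> q i = 0"
      and u: "\<And>i. i < m \<Longrightarrow> u i = of_real (cos \<phi>) * p i + of_real (sin \<phi>) * q i"
      and supp: "\<And>i. u i = 0 \<Longrightarrow> i \<noteq> c \<Longrightarrow> i \<noteq> Suc c \<Longrightarrow> p i = 0 \<and> q i = 0"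
      and real: "\<And>i. cnj (u i) = u i \<Longrightarrow> cnj (p i) = p i \<and> cnj (q i) = q i"
      by (rule split_unit_vector[OF uu _ \<open>c < m\<close> _ \<open>Suc c < m\<close>, of "{c}"]) (simp, simp, rule that)
    have "cnj (u i) = u i" for i
    proof -
      have "bdi_action (f 0) $$ (i, c) = cnj (f 0 $$ (i, c))" if "i < m"
        using that c stiefel_carrier[OF V(1)] by (simp add: bdi_action_def)
      then show ?thesis using V(2) by (simp add: u_def col_fun_def)
    qed
    then have real': "conj_vec p = p" "conj_vec q = q" using real by (auto simp: conj_vec_def)
    show "\<exists>f'. equiv_homotopic f f' \<and> (\<forall>j<Suc c. \<forall>i<m. col_fun (f' 0) j i = basis_vec j i)"
    proof (rule fix_base_column[where adm = adm and R = "rot m" and p = p and q = q and \<phi> = \<phi>])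
      fix f :: "real ^ 'd \<Rightarrow> complex mat" and p q \<theta>
      assume f: "f \<in> equivariant_maps TV bdi_action frame0" and a: "adm p q"
      have comm: "bdi_action (apply_cols (rot m p q \<theta>) A) = apply_cols (rot m p q \<theta>) (bdi_action A)" if "A \<in> V" for \<theta> A
      proof (rule eq_matI)
        fix i j assume "i < dim_row (apply_cols (rot m p q \<theta>) (bdi_action A))" "j < dim_col (apply_cols (rot m p q \<theta>) (bdi_action A))"
        then have ij: "i < m" "j < n" using stiefel_carrier[OF that] by (auto simp: apply_cols_def bdi_action_def)
        have "bdi_action (apply_cols (rot m p q \<theta>) A) $$ (i, j) = conj_vec (rot m p q \<theta> (col_fun A j)) i"
          using ij stiefel_carrier[OF that] by (simp add: bdi_action_def apply_cols_def conj_vec_def)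
        also have "\<dots> = rot m p q \<theta> (conj_vec (col_fun A j)) i"
          using a by (simp add: conj_vec_rot adm_def)
        also have "\<dots> = rot m p q \<theta> (col_fun (bdi_action A) j) i"
          using ij stiefel_carrier[OF that] by (intro rot_cong) (auto simp: conj_vec_def col_fun_def bdi_action_def)
        finally show "bdi_action (apply_cols (rot m p q \<theta>) A) $$ (i, j) = apply_cols (rot m p q \<theta>) (bdi_action A) $$ (i, j)"
          using ij stiefel_carrier[OF that] by (simp add: apply_cols_def bdi_action_def)
      qed (simp_all add: bdi_action_def apply_cols_def)
      have "\<exists>f'. equiv_homotopic f f' \<and> f' 0 = apply_cols (rot m p q (1 * \<theta>)) (f 0)"
        by (rule move_base_point[where R = "\<lambda>t. rot m p q (t * \<theta>)", OF f])
          (use a in \<open>auto simp: ip_rot adm_def rot_0 comm intro!: continuous_on_rot continuous_intros\<close>)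
      then show "\<exists>f'. equiv_homotopic f f' \<and> f' 0 = apply_cols (rot m p q \<theta>) (f 0)" by simp
    next
      show "rot m p q \<theta> x i = of_real (a * cos \<theta> - b * sin \<theta>) * p i + of_real (a * sin \<theta> + b * cos \<theta>) * q i"
        if "adm p q" "\<And>i. i < m \<Longrightarrow> x i = of_real a * p i + of_real b * q i" "i < m" for p q \<theta> a b x i
        using that by (intro rot_combination) (auto simp: adm_def)
    next
      show "rot m p q \<theta> x i = basis_vec j i"
        if "\<And>i. i < c \<Longrightarrow> p i = 0 \<and> q i = 0" "j < c" "\<And>i. i < m \<Longrightarrow> x i = basis_vec j i" "i < m" for p q \<theta> x j i
      proof -
        have "rot m p q \<theta> x = x"
          using that by (intro rot_orthogonal ip_disjoint) (auto simp: basis_vec_def)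
        then show ?thesis using that by simp
      qed
    next
      have "ip m p q = 0" using pq(3,4) by (intro ip_disjoint) blast
      then show "adm p q" using pq real' by (simp add: adm_def)
      show "adm q (basis_vec c)"
        using pq real' \<open>c < m\<close> by (auto simp: adm_def basis_vec_unit ip_basis_right conj_vec_def basis_vec_def)
    next
      show "p i = 0 \<and> q i = 0" if "i < c" for i
      proof -
        have "u i = 0"
          using that c \<open>c < m\<close> stiefel_column_eq_0[OF V(1) c, of i] cols by (simp add: u_def)
        then show ?thesis using supp[of i] that by simp
      qed
    next
      show "col_fun (f 0) c i = of_real (cos \<phi>) * p i + of_real (sin \<phi>) * q i" if "i < m" for i
        using u[OF that] that by (simp add: u_def)
    qed (use f c cols in auto)
  qed
qed

lemma card_classes_cii:
  assumes "n < m" and ev: "even m" "even n" and dim: "CARD('d) \<le> 2 * (m - n)"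
  shows "card (equivariant_homotopy_classes (stiefel_topology m n) (cii_action m n) (canonical_frame m n)
     :: (real ^ 'd \<Rightarrow> complex mat) set set) = 1"
proof -
  interpret frame_involution m n "cii_action m n"
    using assms by (intro frame_involution_cii) auto
  show ?thesis
  proof (intro card_equivariant_homotopy_classes dim fix_base_point)
    fix f :: "real ^ 'd \<Rightarrow> complex mat" and c
    assume f: "f \<in> equivariant_maps TV (cii_action m n) frame0" and c: "c < n"
      and cols: "\<And>i j. j < c \<Longrightarrow> i < m \<Longrightarrow> col_fun (f 0) j i = basis_vec j i"
    note V = equivariant_map_base_point[OF f]
    show "\<exists>f'. equiv_homotopic f f' \<and> (\<forall>j<Suc c. \<forall>i<m. col_fun (f' 0) j i = basis_vec j i)"
    proof (cases "even c")
      case False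
      \<comment> \<open>For odd \<open>c\<close> the preceding column is already a basis vector, and
        symmetry under the action determines column \<open>c\<close>.\<close>
      then have pc: "partner c < c" "even (partner c)" "Suc (partner c) = c" by (auto simp: partner_def elim: oddE)
      have "col_fun (f 0) c i = basis_vec c i" if "i < m" for i
      proof -
        have "col_fun (f 0) c i = quat_vec (col_fun (f 0) (partner c)) i"
          using col_fun_cii[OF ev stiefel_carrier[OF V(1)] that c] V(2) False by simp
        also have "\<dots> = quat_vec (basis_vec (partner c)) i"
          using cols pc that by (intro quat_vec_cong[OF ev(1)]) auto
        finally show ?thesis using pc by (simp add: quat_vec_basis_vec)
      qed
      then have "\<forall>j<Suc c. \<forall>i<m. col_fun (f 0) j i = basis_vec j i"
        using cols by (simp add: less_Suc_eq)
      then show ?thesis using equiv_homotopic_refl[OF f] by blast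
    next
      case True
      define u where "u = col_fun (f 0) c"
      have uu: "ip m u u = 1" using V(1) c by (simp add: stiefel_iff u_def)
      \<comment> \<open>By parity, \<open>c + 2\<close> is at most \<open>n\<close>, hence below
        \<open>m\<close>; row \<open>c + 2\<close> supplies the fallback direction outside the pair
        \<open>c\<close>, \<open>c + 1\<close>.\<close>
      have cm: "c < m" "Suc c < m" "Suc (Suc c) < m"
        using c assms(1) True ev by presburger+
      \<comment> \<open>Here \<open>B\<close> is a whole pair of rows swapped by
        \<open>partner\<close>. So \<open>quat_vec q\<close> also vanishes on \<open>B\<close>,
        which makes it orthogonal to \<open>p\<close>, and \<open>q\<close> is orthogonal to both
        the basis vector \<open>c\<close> and its quaternionic image.\<close>
      obtain p q \<phi> where pq: "ip m p p = 1" "ip m q q = 1" "\<And>i. i \<notin> {c, Suc c} \<Longrightarrow> p i = 0"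
        "\<And>i. i \<in> {c, Suc c} \<Longrightarrow> q i = 0"
        and u: "\<And>i. i < m \<Longrightarrow> u i = of_real (cos \<phi>) * p i + of_real (sin \<phi>) * q i"
        and supp: "\<And>i. u i = 0 \<Longrightarrow> i \<noteq> c \<Longrightarrow> i \<noteq> Suc (Suc c) \<Longrightarrow> p i = 0 \<and> q i = 0"
        by (rule split_unit_vector[OF uu _ cm(1) _ cm(3), of "{c, Suc c}"]) (simp, simp, rule that)
      have Jq: "quat_vec q c = 0" "quat_vec q (Suc c) = 0"
        using pq(4) True by (auto simp: quat_vec_def partner_def)
      show ?thesis
      proof (rule fix_base_column[where adm = "quat_orthonormal m" and R = "quat_rot m" and p = p and q = q and \<phi> = \<phi>])
        fix f :: "real ^ 'd \<Rightarrow> complex mat" and p q \<theta>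
        assume f: "f \<in> equivariant_maps TV (cii_action m n) frame0" and a: "quat_orthonormal m p q"
        have comm: "cii_action m n (apply_cols (quat_rot m p q \<theta>) A) = apply_cols (quat_rot m p q \<theta>) (cii_action m n A)"
          if "A \<in> V" for \<theta> A
        proof (rule eq_matI)
          let ?R = "quat_rot m p q \<theta>"
          have A: "A \<in> carrier_mat m n" "apply_cols ?R A \<in> carrier_mat m n" "cii_action m n A \<in> carrier_mat m n"
            "apply_cols ?R (cii_action m n A) \<in> carrier_mat m n" "cii_action m n (apply_cols ?R A) \<in> carrier_mat m n"
            using stiefel_carrier[OF that] by (simp_all add: apply_cols_carrier cii_carrier ev)
          fix i j assume "i < dim_row (apply_cols ?R (cii_action m n A))" "j < dim_col (apply_cols ?R (cii_action m n A))"
          then have ij: "i < m" "j < n" using A by auto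
          let ?s = "if even j then -1 else 1 :: complex"
          have "col_fun (cii_action m n (apply_cols ?R A)) j i = ?s * quat_vec (col_fun (apply_cols ?R A) (partner j)) i"
            by (rule col_fun_cii[OF ev A(2) ij])
          also have "quat_vec (col_fun (apply_cols ?R A) (partner j)) i = quat_vec (?R (col_fun A (partner j))) i"
            using ij by (intro quat_vec_cong[OF ev(1)] col_fun_apply_cols[OF A(1)] partner_less[OF ev(2)])
          also have "\<dots> = ?R (quat_vec (col_fun A (partner j))) i"
            by (simp add: quat_vec_quat_rot[OF ev(1) a])
          \<comment> \<open>The sign produced by the action is a scalar and passes through the
            complex linear rotation.\<close>
          also have "?s * \<dots> = ?R (\<lambda>i. ?s * quat_vec (col_fun A (partner j)) i) i"
            by (rule quat_rot_scale[symmetric])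
          also have "\<dots> = ?R (col_fun (cii_action m n A) j) i"
            using ij by (intro quat_rot_cong col_fun_cii[OF ev A(1), symmetric])
          also have "\<dots> = col_fun (apply_cols ?R (cii_action m n A)) j i"
            by (rule col_fun_apply_cols[OF A(3) ij, symmetric])
          finally show "cii_action m n (apply_cols ?R A) $$ (i, j) = apply_cols ?R (cii_action m n A) $$ (i, j)"
            by (simp add: col_fun_def)
        qed (use stiefel_carrier[OF that] cii_carrier[OF ev] apply_cols_carrier in \<open>metis carrier_matD\<close>)+
        have "\<exists>f'. equiv_homotopic f f' \<and> f' 0 = apply_cols (quat_rot m p q (1 * \<theta>)) (f 0)"
          by (rule move_base_point[where R = "\<lambda>t. quat_rot m p q (t * \<theta>)", OF f])
            (auto simp: ip_quat_rot[OF ev(1) a] quat_rot_0 comm intro!: continuous_on_quat_rot continuous_intros)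
        then show "\<exists>f'. equiv_homotopic f f' \<and> f' 0 = apply_cols (quat_rot m p q \<theta>) (f 0)" by simp
      next
        show "quat_rot m p q \<theta> x i = of_real (a * cos \<theta> - b * sin \<theta>) * p i + of_real (a * sin \<theta> + b * cos \<theta>) * q i"
          if "quat_orthonormal m p q" and x: "\<And>i. i < m \<Longrightarrow> x i = of_real a * p i + of_real b * q i" and "i < m"
          for p q \<theta> a b x i
        proof -
          note ips = quat_orthonormal_ips[OF ev(1) that(1)]
          have "ip m z x = 0" if "ip m z p = 0" "ip m z q = 0" for z
          proof -
            have "ip m z x = ip m z (\<lambda>i. of_real a * p i + of_real b * q i)"
              using x by (intro ip_cong) auto
            then show ?thesis using that by (simp add: ip_linear)
          qed
          moreover have "ip m (quat_vec p) p = 0" "ip m (quat_vec p) q = 0" "ip m (quat_vec q) p = 0" "ip m (quat_vec q) q = 0"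
            using ips(7-10) by (metis cnj_ip complex_cnj_zero)+
          ultimately have "rot m (quat_vec p) (quat_vec q) \<theta> x = x"
            by (intro rot_orthogonal) auto
          then show ?thesis
            unfolding quat_rot_def using rot_combination[OF ips(1-3) x \<open>i < m\<close>] by simp
        qed
      next
        show "quat_rot m p q \<theta> x i = basis_vec j i"
          if pq: "\<And>i. i < c \<Longrightarrow> p i = 0 \<and> q i = 0" and "j < c" and x: "\<And>i. i < m \<Longrightarrow> x i = basis_vec j i" and "i < m"
          for p q \<theta> x j i
        proof -
          \<comment> \<open>As \<open>c\<close> is even, \<open>partner\<close> maps the rows below
            \<open>c\<close> to themselves, so the images of \<open>p\<close> and \<open>q\<close>
            vanish there as well.\<close>
          have "quat_vec p j = 0" "quat_vec q j = 0"
            using pq[of "partner j"] \<open>j < c\<close> partner_less[OF True] by (auto simp: quat_vec_def)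
          then have "rot m p q \<theta> x = x" "rot m (quat_vec p) (quat_vec q) \<theta> x = x"
            using x pq \<open>j < c\<close> by (auto simp: basis_vec_def intro!: rot_orthogonal ip_disjoint split: if_splits)
          then show ?thesis using x \<open>i < m\<close> by (simp add: quat_rot_def)
        qed
      next
        have "quat_vec q i = 0" if "i \<in> {c, Suc c}" for i using Jq that by auto
        then have "ip m p (quat_vec q) = 0" "ip m p q = 0"
          using pq(3,4) by (auto intro!: ip_disjoint)
        then show "quat_orthonormal m p q"
          using pq by (simp add: quat_orthonormal_def)
        show "quat_orthonormal m q (basis_vec c)"
          using pq cm True by (simp add: quat_orthonormal_def quat_vec_basis_vec ip_basis_right) (simp add: basis_vec_def)
      next
        show "p i = 0 \<and> q i = 0" if "i < c" for i
        proof -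
          have "u i = 0"
            using that c cm stiefel_column_eq_0[OF V(1) c, of i] cols by (simp add: u_def)
          then show ?thesis using supp[of i] that by simp
        qed
      next
        show "col_fun (f 0) c i = of_real (cos \<phi>) * p i + of_real (sin \<phi>) * q i" if "i < m" for i
          using u[OF that] by (simp add: u_def)
      qed (use f c cols in auto)
    qed
  qed
qed

theorem mainTheorem3:
  fixes m n :: nat and g :: "complex mat \<Rightarrow> complex mat"
  assumes "1 \<le> n" and "n \<le> m"
    and "g = bdi_action \<or> (even m \<and> even n \<and> g = cii_action m n)"
    and "int (m - n) \<ge> \<lceil>real CARD('d) / 2\<rceil>"
  shows "card (equivariant_homotopy_classes (stiefel_topology m n) g (canonical_frame m n)
           :: (real ^ 'd::finite \<Rightarrow> complex mat) set set) = 1"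
proof -
  have "real CARD('d) / 2 \<le> real (m - n)"
    using assms(4) by (simp add: ceiling_le_iff)
  then have dim: "CARD('d) \<le> 2 * (m - n)" by linarith
  \<comment> \<open>A cube of positive dimension makes \<open>n < m\<close> strict, which provides
    the spare rows for moving the base point.\<close>
  moreover have "0 < CARD('d)" by simp
  ultimately have "n < m" by linarith
  then show ?thesis
    using assms(3) dim card_classes_bdi[where 'd = 'd] card_classes_cii[where 'd = 'd] by blast
qed

end
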